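(* Let $X$ be a separable complex Banach space and let $T\in\mathfrak L(X)$. Assume that there is a finite or countably infinite family $(E_i)_{i\in I}$ of $\mathbb T$-eigenvector fields for $T$ which is $\lambda$-spanning, where $\lambda$ is Lebesgue measure on $\mathbb T$. Assume moreover that one of the following holds: (a) $X$ has type $2$; (b) $X$ has type $p\in[1,2)$ and each $E_i$ is $\alpha_i$-Hölder continuous for some $\alpha_i>1/p-1/2$. Then $T$ is hereditarily frequently hypercyclic.
   Context: A $\mathbb T$-eigenvector field for $T$ is a bounded map $E:\mathbb T\to X$ with $TE(z)=zE(z)$ for all $z\in\mathbb T$. A family $(E_i)_{i\in I}$ is $\lambda$-spanning if for every Borel set $N\subset\mathbb T$ with $\lambda(N)=0$, the closed linear span of $\{E_i(z): z\in\mathbb T\setminus N, i\in I\}$ is $X$. For $x\in X$, $V\subset X$, $\mathcal N_T(x,V):=\{n\in\mathbb N:T^nx\in V\}$. $T$ is hereditarily frequently hypercyclic if for every countable family $(V_i)_{i\in I}$ of non-empty open sets and every family $(A_i)_{i\in I}$ of subsets of $\mathbb N$ with positive lower density, there exists $x\in X$ with $\mathcal N_T(x,V_i)\cap A_i$ of positive lower density for all $i$. *)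

theory Defs
  imports "HOL-Analysis.Analysis"
begin

text \<open>A complex structure on a real normed space: a scalar multiplication by complex
numbers extending the real one and compatible with the norm. A complex Banach space is
modelled as a real Banach space together with such a structure.\<close>
definition complex_structure :: "(complex \<Rightarrow> 'a::real_normed_vector \<Rightarrow> 'a) \<Rightarrow> bool" where
  "complex_structure sc \<longleftrightarrow>
     (\<forall>a b x. sc (a + b) x = sc a x + sc b x) \<and>
     (\<forall>a x y. sc a (x + y) = sc a x + sc a y) \<and>
     (\<forall>a b x. sc (a * b) x = sc a (sc b x)) \<and>
     (\<forall>r x. sc (complex_of_real r) x = r *\<^sub>R x) \<and>
     (\<forall>a x. norm (sc a x) = cmod a * norm x)"

definition cspan_sc :: "(complex \<Rightarrow> 'a::real_normed_vector \<Rightarrow> 'a) \<Rightarrow> 'a set \<Rightarrow> 'a set" where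
  "cspan_sc sc S = span {sc c x | c x. x \<in> S}"

definition separable_space_UNIV :: "'a::metric_space itself \<Rightarrow> bool" where
  "separable_space_UNIV _ \<longleftrightarrow> (\<exists>D::'a set. countable D \<and> closure D = UNIV)"

definition lambda_T :: "complex measure" where
  "lambda_T = distr (restrict_space lborel {0..2*pi}) borel cis"

definition T_eigenvector_field ::
  "(complex \<Rightarrow> 'a::real_normed_vector \<Rightarrow> 'a) \<Rightarrow> ('a \<Rightarrow> 'a) \<Rightarrow> (complex \<Rightarrow> 'a) \<Rightarrow> bool" where
  "T_eigenvector_field sc T E \<longleftrightarrow>
     bounded (E ` sphere 0 1) \<and> (\<forall>z\<in>sphere 0 1. T (E z) = sc z (E z))"

definition lambda_spanning ::
  "(complex \<Rightarrow> 'a::real_normed_vector \<Rightarrow> 'a) \<Rightarrow> 'i set \<Rightarrow> ('i \<Rightarrow> complex \<Rightarrow> 'a) \<Rightarrow> bool" where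
  "lambda_spanning sc I E \<longleftrightarrow>
     (\<forall>N. N \<in> sets borel \<and> emeasure lambda_T N = 0 \<longrightarrow>
        closure (cspan_sc sc {E i z | i z. i \<in> I \<and> z \<in> sphere 0 1 - N}) = UNIV)"

definition has_type :: "'a::real_normed_vector itself \<Rightarrow> real \<Rightarrow> bool" where
  "has_type _ p \<longleftrightarrow> (\<exists>C. \<forall>n (x::nat \<Rightarrow> 'a).
     ((\<Sum>\<epsilon>\<in>{..<n} \<rightarrow>\<^sub>E {-1::real, 1}. norm (\<Sum>i<n. \<epsilon> i *\<^sub>R x i) powr p) / 2 ^ n) powr (1 / p)
       \<le> C * (\<Sum>i<n. norm (x i) powr p) powr (1 / p))"

definition holder_on_T :: "real \<Rightarrow> (complex \<Rightarrow> 'a::real_normed_vector) \<Rightarrow> bool" where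
  "holder_on_T \<alpha> E \<longleftrightarrow>
     (\<exists>C. \<forall>z\<in>sphere 0 1. \<forall>w\<in>sphere 0 1. norm (E z - E w) \<le> C * cmod (z - w) powr \<alpha>)"

definition pos_lower_density :: "nat set \<Rightarrow> bool" where
  "pos_lower_density A \<longleftrightarrow>
     liminf (\<lambda>n. ereal (real (card (A \<inter> {1..n})) / real n)) > 0"

definition N_T :: "('a \<Rightarrow> 'a) \<Rightarrow> 'a \<Rightarrow> 'a set \<Rightarrow> nat set" where
  "N_T T x V = {n. (T ^^ n) x \<in> V}"

text \<open>Countable families are indexed by subsets J of nat.\<close>
definition hereditarily_frequently_hypercyclic :: "('a::topological_space \<Rightarrow> 'a) \<Rightarrow> bool" where
  "hereditarily_frequently_hypercyclic T \<longleftrightarrow>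
     (\<forall>(J::nat set) (V::nat \<Rightarrow> 'a set) (A::nat \<Rightarrow> nat set).
        (\<forall>j\<in>J. open (V j) \<and> V j \<noteq> {} \<and> pos_lower_density (A j)) \<longrightarrow>
        (\<exists>x. \<forall>j\<in>J. pos_lower_density (N_T T x (V j) \<inter> A j)))"

end

theory Submission
  imports Defs "HOL-Library.Discrete_Functions"
begin

text \<open>The hypercyclic vector is a series of blocks, each block being a finite sum of
eigenvectors \<open>e\<^sub>z\<close> with \<open>T e\<^sub>z = z e\<^sub>z\<close>.

By Weyl's argument (mean square estimates along the squares), for almost every \<open>z\<close> on the
circle the powers \<open>z^m\<close>, \<open>m \<in> A\<close>, come close to every point of the circle along a set of
positive lower density, for any prescribed countable collection of sets \<open>A\<close> of positive lower
density. Choosing the eigenvalues one after the other outside null sets, any finite set of them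
has its powers simultaneously close to prescribed phases along a positive proportion of each
\<open>A\<^sub>j\<close>, so the orbit of a finite sum of blocks returns near a vector of \<open>V\<^sub>j\<close>.

Each new block must not disturb what was already achieved. An eigenvector \<open>E \<zeta>\<close> is
replaced by the mean of \<open>E\<close> over many generic points near \<open>\<zeta>\<close>: this changes the vector
very little, whereas the mean over \<open>m\<close> of the norms along the orbit becomes as small as we
like, by asymptotic orthogonality of the sequences \<open>z^m\<close>. Replacing the block by a suitable
iterate makes these averages small from the very first one on. Hence the
total contribution of later blocks exceeds a threshold only on a set of times of small upper
density.\<close>

section \<open>Mean square estimates on the circle and Weyl's argument\<close>

lemma lambda_T_sets [simp, measurable_cong]: "sets lambda_T = sets borel"
  by (simp add: lambda_T_def)

lemma cis_measurable_interval [measurable]: "cis \<in> restrict_space lborel {0..2*pi} \<rightarrow>\<^sub>M borel"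
proof (rule measurable_restrict_space1)
  have "continuous_on UNIV cis" by (intro continuous_intros)
  then show "cis \<in> lborel \<rightarrow>\<^sub>M borel"
    using borel_measurable_continuous_onI by simp
qed

lemma has_integral_cis_int:
  fixes k :: int
  shows "((\<lambda>t. cis (of_int k * t)) has_integral (if k = 0 then 2 * pi else 0)) {0..2*pi}"
proof (cases "k = 0")
  case True
  have "((\<lambda>t. 1 :: complex) has_integral (2*pi - 0) *\<^sub>R 1) {0..2*pi}"
    using has_integral_const_real[of "1::complex" 0 "2*pi"] by simp
  then show ?thesis using True by (simp add: scaleR_conv_of_real)
next
  case False
  have "((\<lambda>t. exp (\<i> * of_int k * of_real t) / (\<i> * of_int k)) has_vector_derivative
      cis (of_int k * t)) (at t within {0..2*pi})" for t
  proof (rule has_vector_derivative_real_field)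
    show "((\<lambda>z. exp (\<i> * of_int k * z) / (\<i> * of_int k)) has_field_derivative cis (of_int k * t))
        (at (of_real t))"
      using False by (auto intro!: derivative_eq_intros simp: cis_conv_exp mult_ac)
  qed
  then have "((\<lambda>t. cis (of_int k * t)) has_integral
     (exp (\<i> * of_int k * of_real (2*pi)) / (\<i> * of_int k) - exp (\<i> * of_int k * of_real 0) / (\<i> * of_int k))) {0..2*pi}"
    by (intro fundamental_theorem_of_calculus) auto
  moreover have "exp (\<i> * of_int k * of_real (2*pi)) = 1"
    using exp_integer_2pi[of "of_int k"] by (simp add: mult_ac)
  ultimately show ?thesis using False by simp
qed

text \<open>Parseval's identity: the frequencies \<open>n * m\<close> are distinct because
  \<open>n \<ge> 1\<close>, so only the diagonal terms survive integration. The factor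
  \<open>2 * pi\<close> is the total mass of \<open>lambda_T\<close>, which is not
  normalised.\<close>

lemma nn_integral_lambda_T_square:
  fixes b :: "nat \<Rightarrow> complex"
  assumes n: "n \<ge> 1"
  shows "(\<integral>\<^sup>+z. ennreal ((cmod (\<Sum>m<N. b m * z ^ (n * m)))\<^sup>2) \<partial>lambda_T)
       = ennreal (2 * pi * (\<Sum>m<N. (cmod (b m))\<^sup>2))"
proof -
  define f where "f t = (\<Sum>m<N. b m * cis t ^ (n * m))" for t
  have expand: "complex_of_real ((cmod (f t))\<^sup>2) =
      (\<Sum>m<N. \<Sum>m'<N. b m * cnj (b m') * cis (of_int (int n * (int m - int m')) * t))" for t
  proof -
    have "complex_of_real ((cmod (f t))\<^sup>2) = f t * cnj (f t)"
      by (rule complex_norm_square)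
    also have "\<dots> = (\<Sum>m<N. \<Sum>m'<N. (b m * cis t ^ (n * m)) * cnj (b m' * cis t ^ (n * m')))"
      by (simp add: f_def sum_product)
    also have "\<dots> = (\<Sum>m<N. \<Sum>m'<N. b m * cnj (b m') * cis (of_int (int n * (int m - int m')) * t))"
    proof (intro sum.cong refl)
      fix m m'
      have "cis t ^ (n * m) * cnj (cis t ^ (n * m')) = cis (of_int (int n * (int m - int m')) * t)"
        by (simp add: Complex.DeMoivre cis_cnj cis_mult algebra_simps)
      then show "(b m * cis t ^ (n * m)) * cnj (b m' * cis t ^ (n * m'))
          = b m * cnj (b m') * cis (of_int (int n * (int m - int m')) * t)"
        by (simp add: mult_ac)
    qed
    finally show ?thesis .
  qed
  have "((\<lambda>t. \<Sum>m<N. \<Sum>m'<N. b m * cnj (b m') * cis (of_int (int n * (int m - int m')) * t)) has_integral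
     (\<Sum>m<N. \<Sum>m'<N. b m * cnj (b m') * (if int n * (int m - int m') = 0 then 2 * pi else 0))) {0..2*pi}"
    by (intro has_integral_sum finite_lessThan has_integral_mult_right has_integral_cis_int)
  also have "(\<Sum>m<N. \<Sum>m'<N. b m * cnj (b m') * (if int n * (int m - int m') = 0 then 2 * pi else 0))
     = (\<Sum>m<N. \<Sum>m'<N. if m' = m then b m * cnj (b m) * (2 * pi) else 0)"
    using n by (intro sum.cong refl) auto
  also have "\<dots> = complex_of_real (2 * pi * (\<Sum>m<N. (cmod (b m))\<^sup>2))"
    by (simp add: sum_distrib_left complex_norm_square[symmetric] mult_ac flip: of_real_power)
  finally have "((\<lambda>t. complex_of_real ((cmod (f t))\<^sup>2)) has_integral
      complex_of_real (2 * pi * (\<Sum>m<N. (cmod (b m))\<^sup>2))) {0..2*pi}"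
    by (simp only: expand)
  then have I: "((\<lambda>t. (cmod (f t))\<^sup>2) has_integral (2 * pi * (\<Sum>m<N. (cmod (b m))\<^sup>2))) {0..2*pi}"
    by (drule_tac has_integral_linear[OF _ bounded_linear_Re]) (simp only: o_def Re_complex_of_real)
  have "(\<integral>\<^sup>+z. ennreal ((cmod (\<Sum>m<N. b m * z ^ (n * m)))\<^sup>2) \<partial>lambda_T)
      = (\<integral>\<^sup>+t. ennreal ((cmod (f t))\<^sup>2) \<partial>(restrict_space lborel {0..2*pi}))"
    unfolding lambda_T_def f_def by (subst nn_integral_distr) auto
  also have "\<dots> = (\<integral>\<^sup>+t. ennreal ((cmod (f t))\<^sup>2) * indicator {0..2*pi} t \<partial>lborel)"
    by (subst nn_integral_restrict_space) auto
  also have "\<dots> = ennreal (2 * pi * (\<Sum>m<N. (cmod (b m))\<^sup>2))"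
    by (rule nn_integral_has_integral_lebesgue'[OF _ I]) auto
  finally show ?thesis .
qed

text \<open>Between \<open>k\<^sup>2\<close> and any \<open>n < (Suc k)\<^sup>2\<close> the value of
  \<open>S\<close> changes by at most \<open>2 * k\<close>, which is negligible against
  \<open>k\<^sup>2\<close>.\<close>

lemma average_tendsto_zero_of_squares:
  fixes S :: "nat \<Rightarrow> complex"
  assumes step: "\<And>n. cmod (S (Suc n) - S n) \<le> 1"
    and sq: "(\<lambda>k. S (k\<^sup>2) / of_nat (k\<^sup>2)) \<longlonglongrightarrow> 0"
  shows "(\<lambda>n. S n / of_nat n) \<longlonglongrightarrow> 0"
proof -
  have incr: "cmod (S (a + d) - S a) \<le> real d" for a d
  proof (induction d)
    case (Suc d)
    have "cmod (S (a + Suc d) - S a) \<le> cmod (S (Suc (a + d)) - S (a + d)) + cmod (S (a + d) - S a)"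
      using norm_triangle_ineq[of "S (Suc (a + d)) - S (a + d)" "S (a + d) - S a"] by simp
    then show ?case using Suc step[of "a + d"] by simp
  qed simp
  have bound: "cmod (S n / of_nat n) \<le>
      cmod (S ((floor_sqrt n)\<^sup>2) / of_nat ((floor_sqrt n)\<^sup>2)) + 2 / real (floor_sqrt n)"
    if "n \<ge> 1" for n
  proof -
    define k where "k = floor_sqrt n"
    have k2: "k\<^sup>2 \<le> n" by (simp add: k_def)
    have k1: "k \<ge> 1" using that by (simp add: k_def le_floor_sqrt_iff)
    have "n < (Suc k)\<^sup>2" unfolding k_def by (rule Suc_floor_sqrt_power2_gt)
    then have d: "n - k\<^sup>2 \<le> 2 * k" by (simp add: power2_eq_square)
    have "cmod (S n) \<le> cmod (S (k\<^sup>2)) + cmod (S (k\<^sup>2 + (n - k\<^sup>2)) - S (k\<^sup>2))"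
      using k2 norm_triangle_ineq[of "S (k\<^sup>2)" "S n - S (k\<^sup>2)"] by simp
    also have "\<dots> \<le> cmod (S (k\<^sup>2)) + 2 * real k"
    proof -
      have "real (n - k\<^sup>2) \<le> real (2 * k)" using d by (rule of_nat_mono)
      then show ?thesis using incr[of "k\<^sup>2" "n - k\<^sup>2"] by simp
    qed
    finally have "cmod (S n) / real n \<le> (cmod (S (k\<^sup>2)) + 2 * real k) / real n"
      by (simp add: divide_right_mono)
    also have "\<dots> \<le> (cmod (S (k\<^sup>2)) + 2 * real k) / real (k\<^sup>2)"
      using k1 k2 that by (intro divide_left_mono mult_pos_pos) (auto simp del: of_nat_power)
    also have "\<dots> = cmod (S (k\<^sup>2)) / real (k\<^sup>2) + 2 / real k"
      using k1 by (simp add: field_simps power2_eq_square)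
    finally show ?thesis by (simp add: k_def norm_divide norm_power)
  qed
  have fs: "filterlim floor_sqrt at_top sequentially"
    unfolding filterlim_at_top
  proof
    fix Z :: nat
    show "\<forall>\<^sub>F n in sequentially. Z \<le> floor_sqrt n"
      using eventually_ge_at_top[of "Z\<^sup>2"] by eventually_elim (rule le_floor_sqrtI)
  qed
  have "(\<lambda>k. cmod (S (k\<^sup>2) / of_nat (k\<^sup>2)) + 2 / real k) \<longlonglongrightarrow> 0"
    using tendsto_add[OF tendsto_norm_zero[OF sq] lim_const_over_n[of 2]] by simp
  then have "(\<lambda>n. cmod (S ((floor_sqrt n)\<^sup>2) / of_nat ((floor_sqrt n)\<^sup>2)) + 2 / real (floor_sqrt n)) \<longlonglongrightarrow> 0"
    by (rule filterlim_compose[OF _ fs])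
  then show ?thesis
    by (rule Lim_null_comparison[rotated])
       (use eventually_ge_at_top[of 1] in eventually_elim, use bound in blast)
qed

text \<open>The averages over the first \<open>k\<^sup>2\<close> terms have square integral at most
  \<open>2 * pi / k\<^sup>2\<close>, which is summable in \<open>k\<close>. Their squares therefore
  form a convergent series for almost every \<open>z\<close>, so the averages along the squares tend
  to zero, and the gaps between squares are harmless.\<close>

lemma AE_lambda_T_averages_tendsto_zero:
  fixes b :: "nat \<Rightarrow> complex"
  assumes n: "n \<ge> 1" and b: "\<And>m. cmod (b m) \<le> 1"
  shows "AE z in lambda_T. cmod z = 1 \<longrightarrow>
           (\<lambda>N. (\<Sum>m<N. b m * z ^ (n * m)) / of_nat N) \<longlonglongrightarrow> 0"
proof -
  define S where "S z N = (\<Sum>m<N. b m * z ^ (n * m))" for z N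
  define g where "g k z = (cmod (S z (k\<^sup>2) / of_nat (k\<^sup>2)))\<^sup>2" for k z
  have meas: "(\<lambda>z. ennreal (g k z)) \<in> borel_measurable lambda_T" for k
    unfolding g_def S_def by measurable
  have int: "(\<integral>\<^sup>+z. ennreal (g k z) \<partial>lambda_T) \<le> ennreal (2 * pi * (1 / (real k)\<^sup>2))" for k
  \<comment> \<open>At \<open>k = 0\<close> both sides are zero, since division by zero yields
    zero.\<close>
  proof (cases "k = 0")
    case True
    then show ?thesis by (simp add: g_def)
  next
    case False
    have "g k z = (1 / (real (k\<^sup>2))\<^sup>2) * (cmod (S z (k\<^sup>2)))\<^sup>2" for z
      by (simp add: g_def norm_divide norm_power power_divide)
    then have "(\<integral>\<^sup>+z. ennreal (g k z) \<partial>lambda_T)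
       = (\<integral>\<^sup>+z. ennreal (1 / (real (k\<^sup>2))\<^sup>2) * ennreal ((cmod (S z (k\<^sup>2)))\<^sup>2) \<partial>lambda_T)"
      by (simp only: ennreal_mult' zero_le_divide_1_iff zero_le_power2)
    also have "\<dots> = ennreal (1 / (real (k\<^sup>2))\<^sup>2) * (\<integral>\<^sup>+z. ennreal ((cmod (S z (k\<^sup>2)))\<^sup>2) \<partial>lambda_T)"
      unfolding S_def by (rule nn_integral_cmult) measurable
    also have "\<dots> = ennreal (1 / (real (k\<^sup>2))\<^sup>2 * (2 * pi * (\<Sum>m<k\<^sup>2. (cmod (b m))\<^sup>2)))"
      unfolding S_def by (subst nn_integral_lambda_T_square[OF n]) (simp only: ennreal_mult' zero_le_divide_1_iff zero_le_power2)
    also have "\<dots> \<le> ennreal (1 / (real (k\<^sup>2))\<^sup>2 * (2 * pi * real (k\<^sup>2)))"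
    proof -
      have "(\<Sum>m<k\<^sup>2. (cmod (b m))\<^sup>2) \<le> (\<Sum>m<k\<^sup>2. 1)"
        by (intro sum_mono) (simp add: b power_le_one)
      then show ?thesis by (intro ennreal_leI mult_left_mono) auto
    qed
    also have "1 / (real (k\<^sup>2))\<^sup>2 * (2 * pi * real (k\<^sup>2)) = 2 * pi * (1 / (real k)\<^sup>2)"
      using False by (simp add: power2_eq_square)
    finally show ?thesis .
  qed
  have "(\<integral>\<^sup>+z. (\<Sum>k. ennreal (g k z)) \<partial>lambda_T) = (\<Sum>k. \<integral>\<^sup>+z. ennreal (g k z) \<partial>lambda_T)"
    by (rule nn_integral_suminf) (rule meas)
  also have "\<dots> \<le> (\<Sum>k. ennreal (2 * pi * (1 / (real k)\<^sup>2)))"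
    by (intro suminf_le int) auto
  also have "\<dots> < top"
  proof -
    have "summable (\<lambda>k. 2 * pi * (1 / (real k)\<^sup>2))"
      using inverse_power_summable[of 2, where 'a = real]
      by (intro summable_mult) (simp add: field_simps)
    then show ?thesis by (simp add: suminf_ennreal2 del: suminf_ennreal)
  qed
  finally have "(\<integral>\<^sup>+z. (\<Sum>k. ennreal (g k z)) \<partial>lambda_T) \<noteq> \<infinity>" by auto
  then have "AE z in lambda_T. (\<Sum>k. ennreal (g k z)) \<noteq> \<infinity>"
    by (intro nn_integral_PInf_AE borel_measurable_suminf_order meas)
  then show ?thesis
  proof eventually_elim
    case (elim z)
    show ?case
    proof
      assume z: "cmod z = 1"
      have "summable (\<lambda>k. g k z)"
        using elim by (intro summable_suminf_not_top) (auto simp: g_def)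
      then have "(\<lambda>k. g k z) \<longlonglongrightarrow> 0" by (rule summable_LIMSEQ_zero)
      then have "(\<lambda>k. sqrt (g k z)) \<longlonglongrightarrow> sqrt 0" by (rule tendsto_real_sqrt)
      then have "(\<lambda>k. S z (k\<^sup>2) / of_nat (k\<^sup>2)) \<longlonglongrightarrow> 0"
        by (simp add: g_def tendsto_norm_zero_iff)
      moreover have "cmod (S z (Suc N) - S z N) \<le> 1" for N
        using b[of N] z by (simp add: S_def norm_mult norm_power)
      ultimately have "(\<lambda>N. S z N / of_nat N) \<longlonglongrightarrow> 0"
        by (intro average_tendsto_zero_of_squares)
      then show "(\<lambda>N. (\<Sum>m<N. b m * z ^ (n * m)) / of_nat N) \<longlonglongrightarrow> 0"
        by (simp add: S_def)
    qed
  qed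
qed

section \<open>Lower density and returns of the powers of one point\<close>

text \<open>Trades the liminf for an explicit constant that counting arguments can use. Passing
  between \<open>{1..n}\<close> and \<open>{..<n}\<close> costs at most one point, and this is at
  most \<open>c / 2 * real n\<close> once \<open>2 / c \<le> real n\<close>.\<close>

lemma pos_lower_density_iff:
  "pos_lower_density A \<longleftrightarrow> (\<exists>c>0. \<forall>\<^sub>F n in sequentially. c * real n \<le> real (card (A \<inter> {..<n})))"
proof
  assume "pos_lower_density A"
  then obtain c where c: "0 < ereal c" "ereal c < liminf (\<lambda>n. ereal (real (card (A \<inter> {1..n})) / real n))"
    unfolding pos_lower_density_def zero_ereal_def using ereal_dense2 by blast
  then have "\<forall>\<^sub>F n in sequentially. ereal c < ereal (real (card (A \<inter> {1..n})) / real n)"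
    by (rule_tac less_LiminfD) auto
  moreover have "\<forall>\<^sub>F n in sequentially. n \<ge> 1 \<and> 2 / c \<le> real n"
    by (intro eventually_conj eventually_ge_at_top
        filterlim_real_sequentially[unfolded filterlim_at_top, rule_format])
  ultimately have "\<forall>\<^sub>F n in sequentially. c / 2 * real n \<le> real (card (A \<inter> {..<n}))"
  proof eventually_elim
    case (elim n)
    have "A \<inter> {1..n} \<subseteq> insert n (A \<inter> {..<n})" by auto
    then have "card (A \<inter> {1..n}) \<le> card (insert n (A \<inter> {..<n}))" by (intro card_mono) auto
    also have "\<dots> = Suc (card (A \<inter> {..<n}))" by simp
    finally have "real (card (A \<inter> {1..n})) \<le> real (card (A \<inter> {..<n})) + 1" by simp
    moreover have "c * real n < real (card (A \<inter> {1..n}))" "1 \<le> c / 2 * real n"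
      using elim c(1) by (auto simp: field_simps)
    ultimately show ?case by (simp add: field_simps)
  qed
  then show "\<exists>c>0. \<forall>\<^sub>F n in sequentially. c * real n \<le> real (card (A \<inter> {..<n}))"
    using c(1) by (intro exI[of _ "c/2"]) auto
next
  assume "\<exists>c>0. \<forall>\<^sub>F n in sequentially. c * real n \<le> real (card (A \<inter> {..<n}))"
  then obtain c where c: "c > 0" "\<forall>\<^sub>F n in sequentially. c * real n \<le> real (card (A \<inter> {..<n}))"
    by blast
  have "\<forall>\<^sub>F n in sequentially. n \<ge> 1 \<and> 2 / c \<le> real n"
    by (intro eventually_conj eventually_ge_at_top
        filterlim_real_sequentially[unfolded filterlim_at_top, rule_format])
  with c(2) have "\<forall>\<^sub>F n in sequentially. ereal (c / 2) \<le> ereal (real (card (A \<inter> {1..n})) / real n)"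
  proof eventually_elim
    case (elim n)
    have "A \<inter> {..<n} \<subseteq> insert 0 (A \<inter> {1..n})" by auto
    then have "card (A \<inter> {..<n}) \<le> card (insert 0 (A \<inter> {1..n}))" by (intro card_mono) auto
    also have "\<dots> = Suc (card (A \<inter> {1..n}))" by simp
    finally have "real (card (A \<inter> {..<n})) \<le> real (card (A \<inter> {1..n})) + 1" by simp
    moreover have "1 \<le> c / 2 * real n"
      using elim c(1) by (auto simp: field_simps)
    ultimately show ?case using elim by (simp add: field_simps)
  qed
  then have "ereal (c / 2) \<le> liminf (\<lambda>n. ereal (real (card (A \<inter> {1..n})) / real n))"
    by (rule Liminf_bounded)
  moreover have "0 < ereal (c / 2)" using c(1) by simp
  ultimately show "pos_lower_density A"
    unfolding pos_lower_density_def by (rule less_le_trans[rotated])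
qed

lemma pos_lower_density_mono:
  assumes "pos_lower_density A" "A \<subseteq> B"
  shows "pos_lower_density B"
proof -
  obtain c where c: "c > 0" "\<forall>\<^sub>F n in sequentially. c * real n \<le> real (card (A \<inter> {..<n}))"
    using assms(1) unfolding pos_lower_density_iff by blast
  have "card (A \<inter> {..<n}) \<le> card (B \<inter> {..<n})" for n
    using assms(2) by (intro card_mono) auto
  then have "\<forall>\<^sub>F n in sequentially. c * real n \<le> real (card (B \<inter> {..<n}))"
    using c(2) by (rule_tac eventually_mono[OF c(2)]) (meson of_nat_le_iff order_trans)
  then show ?thesis using c(1) unfolding pos_lower_density_iff by blast
qed

lemma pos_lower_density_UNIV: "pos_lower_density UNIV"
  unfolding pos_lower_density_iff by (intro exI[of _ 1]) auto

text \<open>The cross terms in the expansion of the square average out.\<close>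
lemma average_norm_square_sum:
  fixes b :: "nat \<Rightarrow> complex" and u :: "'k \<Rightarrow> nat \<Rightarrow> complex"
  assumes K: "finite K"
    and orth: "\<And>i j. i \<in> K \<Longrightarrow> j \<in> K \<Longrightarrow> i \<noteq> j \<Longrightarrow>
        (\<lambda>N. (\<Sum>m<N. b m * (u i m * cnj (u j m))) / of_nat N) \<longlonglongrightarrow> 0"
    and unit: "\<And>i m. i \<in> K \<Longrightarrow> cmod (u i m) = 1"
  shows "(\<lambda>N. ((\<Sum>m<N. b m * of_real ((cmod (\<Sum>i\<in>K. \<alpha> i * u i m))\<^sup>2))
              - of_real (\<Sum>i\<in>K. (cmod (\<alpha> i))\<^sup>2) * (\<Sum>m<N. b m)) / of_nat N) \<longlonglongrightarrow> 0"
proof -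
  define R where "R i j N = (\<Sum>m<N. b m * (u i m * cnj (u j m)))" for i j N
  have diag: "R i i N = (\<Sum>m<N. b m)" if "i \<in> K" for i N
    using unit[OF that] by (simp add: R_def complex_norm_square[symmetric])
  have "(\<Sum>m<N. b m * of_real ((cmod (\<Sum>i\<in>K. \<alpha> i * u i m))\<^sup>2))
      - of_real (\<Sum>i\<in>K. (cmod (\<alpha> i))\<^sup>2) * (\<Sum>m<N. b m)
      = (\<Sum>i\<in>K. \<Sum>j\<in>K - {i}. \<alpha> i * cnj (\<alpha> j) * R i j N)" for N
  proof -
    have "(\<Sum>m<N. b m * of_real ((cmod (\<Sum>i\<in>K. \<alpha> i * u i m))\<^sup>2))
        = (\<Sum>m<N. \<Sum>i\<in>K. \<Sum>j\<in>K. \<alpha> i * cnj (\<alpha> j) * (b m * (u i m * cnj (u j m))))"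
    proof (rule sum.cong[OF refl])
      fix m
      have "b m * of_real ((cmod (\<Sum>i\<in>K. \<alpha> i * u i m))\<^sup>2)
          = b m * (\<Sum>i\<in>K. \<Sum>j\<in>K. (\<alpha> i * u i m) * cnj (\<alpha> j * u j m))"
        by (simp only: complex_norm_square cnj_sum sum_product)
      then show "b m * of_real ((cmod (\<Sum>i\<in>K. \<alpha> i * u i m))\<^sup>2)
          = (\<Sum>i\<in>K. \<Sum>j\<in>K. \<alpha> i * cnj (\<alpha> j) * (b m * (u i m * cnj (u j m))))"
        by (simp add: sum_distrib_left mult_ac)
    qed
    also have "\<dots> = (\<Sum>i\<in>K. \<Sum>j\<in>K. \<Sum>m<N. \<alpha> i * cnj (\<alpha> j) * (b m * (u i m * cnj (u j m))))"
      by (subst sum.swap, rule sum.cong[OF refl], rule sum.swap)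
    also have "\<dots> = (\<Sum>i\<in>K. \<Sum>j\<in>K. \<alpha> i * cnj (\<alpha> j) * R i j N)"
      by (simp add: R_def sum_distrib_left)
    also have "\<dots> = (\<Sum>i\<in>K. \<alpha> i * cnj (\<alpha> i) * R i i N + (\<Sum>j\<in>K - {i}. \<alpha> i * cnj (\<alpha> j) * R i j N))"
      using K by (intro sum.cong refl sum.remove) auto
    also have "\<dots> = of_real (\<Sum>i\<in>K. (cmod (\<alpha> i))\<^sup>2) * (\<Sum>m<N. b m)
        + (\<Sum>i\<in>K. \<Sum>j\<in>K - {i}. \<alpha> i * cnj (\<alpha> j) * R i j N)"
      by (simp only: sum.distrib of_real_sum complex_norm_square sum_distrib_right)
         (simp add: diag)
    finally show ?thesis by simp
  qed
  then have eq: "((\<Sum>m<N. b m * of_real ((cmod (\<Sum>i\<in>K. \<alpha> i * u i m))\<^sup>2))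
      - of_real (\<Sum>i\<in>K. (cmod (\<alpha> i))\<^sup>2) * (\<Sum>m<N. b m)) / of_nat N
      = (\<Sum>i\<in>K. \<Sum>j\<in>K - {i}. \<alpha> i * cnj (\<alpha> j) * (R i j N / of_nat N))" for N
    by (simp add: sum_divide_distrib)
  have "(\<lambda>N. \<Sum>i\<in>K. \<Sum>j\<in>K - {i}. \<alpha> i * cnj (\<alpha> j) * (R i j N / of_nat N))
      \<longlonglongrightarrow> (\<Sum>i\<in>K. \<Sum>j\<in>K - {i}. \<alpha> i * cnj (\<alpha> j) * 0)"
    unfolding R_def by (intro tendsto_sum tendsto_mult_left orth) auto
  then show ?thesis unfolding eq by simp
qed

text \<open>The trigonometric polynomial \<open>\<bar>(1 + w)^r\<bar>\<^sup>2 / 4^r\<close> has mean at least \<open>1 / (r + 1)\<close>,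
but is exponentially small in \<open>r\<close> away from \<open>w = 1\<close>.\<close>
lemma pos_lower_density_return:
  assumes z: "cmod z = 1" and A: "pos_lower_density A"
    and weyl: "\<And>n. n \<ge> 1 \<Longrightarrow> (\<lambda>N. (\<Sum>m<N. indicator A m * z ^ (n * m)) / of_nat N) \<longlonglongrightarrow> 0"
    and a: "cmod a = 1" and \<delta>: "\<delta> > 0"
  shows "pos_lower_density {m\<in>A. cmod (z ^ m - a) < \<delta>}"
proof -
  define \<delta>' where "\<delta>' = min \<delta> 1"
  \<comment> \<open>For unimodular \<open>w\<close>, the square of \<open>cmod (1 + w)\<close> is 4
    minus the square of \<open>cmod (w - 1)\<close>. So \<open>\<rho>\<close> bounds a quarter of it
    wherever \<open>w\<close> is at distance at least \<open>\<delta>'\<close> from 1. The cap of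
    \<open>\<delta>'\<close> at 1 keeps \<open>\<rho>\<close> positive.\<close>
  define \<rho> where "\<rho> = 1 - \<delta>'\<^sup>2 / 4"
  have \<delta>': "0 < \<delta>'" "\<delta>' \<le> 1" "\<delta>' \<le> \<delta>" using \<delta> by (auto simp: \<delta>'_def)
  have "\<delta>'\<^sup>2 \<le> 1" using \<delta>' by (simp add: power_le_one)
  then have \<rho>: "0 < \<rho>" "\<rho> < 1" using \<delta>' by (auto simp: \<rho>_def)
  have "(\<lambda>r. real (Suc r) * \<rho> ^ Suc r) \<longlonglongrightarrow> 0"
    using powser_times_n_limit_0[of \<rho>] \<rho> by (intro LIMSEQ_Suc[of "\<lambda>r. real r * \<rho> ^ r"]) simp
  then have "\<forall>\<^sub>F r in sequentially. real (Suc r) * \<rho> ^ Suc r < \<rho> / 2"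
    by (rule order_tendstoD) (use \<rho> in simp)
  \<comment> \<open>The exponential decay of \<open>\<rho> ^ r\<close> beats
    \<open>1 / real (Suc r)\<close>: for this \<open>r\<close> it is less than half of it.\<close>
  then obtain r where "real (Suc r) * \<rho> ^ Suc r < \<rho> / 2"
    using eventually_happens'[OF sequentially_bot] by blast
  then have "\<rho> * (2 * real (Suc r) * \<rho> ^ r) < \<rho> * 1" by (simp add: algebra_simps)
  then have "2 * real (Suc r) * \<rho> ^ r < 1" using \<rho> by (simp only: mult_less_cancel_left_pos)
  then have r: "\<rho> ^ r < 1 / (2 * real (Suc r))" by (simp add: field_simps)

  \<comment> \<open>Rotating by \<open>cnj a\<close> moves the target phase \<open>a\<close> to
    1.\<close>
  define w where "w m = cnj a * z ^ m" for m
  have w1: "cmod (w m) = 1" for m by (simp add: w_def norm_mult norm_power z a)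
  have wa: "cmod (w m - 1) = cmod (z ^ m - a)" for m
  proof -
    have "w m - 1 = cnj a * (z ^ m - a)"
      using a complex_norm_square[of a] by (simp add: w_def algebra_simps)
    then show ?thesis by (simp add: norm_mult a)
  qed
  define f where "f m = (cmod (\<Sum>i\<le>r. (of_nat (r choose i) / 2 ^ r) * w m ^ i))\<^sup>2" for m
  have f: "f m = ((cmod (1 + w m))\<^sup>2 / 4) ^ r" for m
  proof -
    have "(\<Sum>i\<le>r. (of_nat (r choose i) / 2 ^ r) * w m ^ i) = (w m + 1) ^ r / 2 ^ r"
      by (simp add: binomial_ring sum_divide_distrib)
    then have "f m = ((cmod (1 + w m)) ^ r / 2 ^ r)\<^sup>2"
      by (simp add: f_def norm_divide norm_power add.commute)
    also have "\<dots> = ((cmod (1 + w m))\<^sup>2 / 2\<^sup>2) ^ r"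
      by (simp only: power_divide[symmetric] power_mult[symmetric] mult.commute)
    finally show ?thesis by simp
  qed
  have par: "(cmod (1 + w m))\<^sup>2 = 4 - (cmod (w m - 1))\<^sup>2" for m
  proof -
    have "(Re (w m))\<^sup>2 + (Im (w m))\<^sup>2 = 1" using w1[of m] by (simp add: cmod_def)
    then show ?thesis unfolding cmod_power2 by (simp add: power2_eq_square algebra_simps)
  qed
  have f_le1: "f m \<le> 1" for m
  proof -
    have "(cmod (1 + w m))\<^sup>2 \<le> 4" unfolding par by simp
    then show ?thesis unfolding f by (intro power_le_one) auto
  qed
  have f_le: "f m \<le> \<rho> ^ r" if "cmod (z ^ m - a) \<ge> \<delta>" for m
  proof -
    have "\<delta>'\<^sup>2 \<le> (cmod (w m - 1))\<^sup>2" using that \<delta>' by (intro power_mono) (auto simp: wa)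
    then have "(cmod (1 + w m))\<^sup>2 / 4 \<le> \<rho>" by (simp add: par \<rho>_def)
    then show ?thesis unfolding f by (intro power_mono) auto
  qed
  \<comment> \<open>The sum of the squared coefficients is the asymptotic mean of \<open>f\<close>
    along \<open>A\<close>. The \<open>r + 1\<close> coefficients add up to 1, so Cauchy-Schwarz
    bounds it below.\<close>
  define \<kappa> where "\<kappa> = (\<Sum>i\<le>r. (cmod (of_nat (r choose i) / 2 ^ r))\<^sup>2)"
  have \<kappa>: "\<kappa> \<ge> 1 / real (Suc r)"
  proof -
    have "(\<Sum>i\<le>r. real (r choose i) / 2 ^ r)\<^sup>2 \<le> (\<Sum>i\<le>r. (real (r choose i) / 2 ^ r)\<^sup>2) * (\<Sum>i\<le>r. 1\<^sup>2)"
      using Cauchy_Schwarz_ineq_sum[of "\<lambda>i. real (r choose i) / 2 ^ r" "\<lambda>_. 1" "{..r}"] by simp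
    moreover have "(\<Sum>i\<le>r. real (r choose i) / 2 ^ r) = 1"
      using choose_row_sum[of r] by (simp flip: sum_divide_distrib of_nat_sum)
    ultimately have "1 \<le> \<kappa> * real (Suc r)"
      by (simp add: \<kappa>_def norm_divide norm_power)
    then show ?thesis by (simp add: field_simps)
  qed

  \<comment> \<open>For \<open>i > j\<close> the cross term is a constant multiple of
    \<open>z ^ ((i - j) * m)\<close>, to which \<open>weyl\<close> applies. The case
    \<open>i < j\<close> follows by conjugation, as the indicator is real.\<close>
  have lim: "(\<lambda>N. ((\<Sum>m<N. indicator A m * of_real (f m)) - of_real \<kappa> * (\<Sum>m<N. indicator A m :: complex))
        / of_nat N) \<longlonglongrightarrow> 0"
    unfolding f_def \<kappa>_def
  proof (rule average_norm_square_sum)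
    fix i j assume ij: "i \<in> {..r}" "j \<in> {..r}" "i \<noteq> j"
    have ww: "w m * cnj (w m) = 1" for m
      using w1[of m] complex_norm_square[of "w m"] by simp
    have gt: "(\<lambda>N. (\<Sum>m<N. indicator A m * (w m ^ i * cnj (w m ^ j))) / of_nat N) \<longlonglongrightarrow> 0"
      if "i > j" for i j
    proof -
      have "w m ^ i * cnj (w m ^ j) = cnj a ^ (i - j) * z ^ ((i - j) * m)" for m
      proof -
        have "w m ^ i * cnj (w m ^ j) = w m ^ (i - j) * (w m * cnj (w m)) ^ j"
          using that by (simp add: power_mult_distrib mult.assoc flip: power_add)
        also have "\<dots> = cnj a ^ (i - j) * z ^ ((i - j) * m)"
          by (simp add: ww) (simp add: w_def power_mult_distrib mult.commute flip: power_mult)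
        finally show ?thesis .
      qed
      then have "(\<Sum>m<N. indicator A m * (w m ^ i * cnj (w m ^ j))) / of_nat N
          = cnj a ^ (i - j) * ((\<Sum>m<N. indicator A m * z ^ ((i - j) * m)) / of_nat N)" for N
        by (simp add: sum_distrib_left mult_ac)
      moreover have "(\<lambda>N. cnj a ^ (i - j) * ((\<Sum>m<N. indicator A m * z ^ ((i - j) * m)) / of_nat N))
          \<longlonglongrightarrow> cnj a ^ (i - j) * 0"
        using that by (intro tendsto_mult_left weyl) auto
      ultimately show ?thesis by (simp only: mult_zero_right)
    qed
    show "(\<lambda>N. (\<Sum>m<N. indicator A m * (w m ^ i * cnj (w m ^ j))) / of_nat N) \<longlonglongrightarrow> 0"
    proof (cases "i > j")
      case True
      then show ?thesis by (rule gt)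
    next
      case False
      with ij have "i < j" by simp
      have "cnj (indicator A m) = (indicator A m :: complex)" for m by (simp add: indicator_def)
      then have "(\<Sum>m<N. indicator A m * (w m ^ i * cnj (w m ^ j))) / of_nat N
          = cnj ((\<Sum>m<N. indicator A m * (w m ^ j * cnj (w m ^ i))) / of_nat N)" for N
        by (simp add: mult_ac)
      with tendsto_cnj[OF gt[OF \<open>i < j\<close>]] show ?thesis by (simp only: complex_cnj_zero)
    qed
  qed (auto simp: w1 norm_power)
  define G where "G = {m\<in>A. cmod (z ^ m - a) < \<delta>}"
  \<comment> \<open>A lower bound for the gap between the mean of \<open>f\<close> along
    \<open>A\<close> and the size of \<open>f\<close> at the times when \<open>z ^ m\<close> is far
    from \<open>a\<close>.\<close>
  define d where "d = 1 / (2 * real (Suc r))"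
  have d: "0 < d" "d < \<kappa> - \<rho> ^ r" using \<kappa> r by (auto simp: d_def field_simps)
  obtain c where c: "c > 0" "\<forall>\<^sub>F n in sequentially. c * real n \<le> real (card (A \<inter> {..<n}))"
    using A unfolding pos_lower_density_iff by blast
  have "\<forall>\<^sub>F N in sequentially. dist (((\<Sum>m<N. indicator A m * of_real (f m))
      - of_real \<kappa> * (\<Sum>m<N. indicator A m :: complex)) / of_nat N) 0 < d * c / 2"
    using lim by (rule tendstoD) (use c d in auto)
  \<comment> \<open>The sum of \<open>f\<close> over \<open>A \<inter> {..<N}\<close> is at least
    \<open>\<kappa>\<close> times the number of its points, up to an error
    \<open>d * c / 2 * real N\<close>. It is at most the number of points of \<open>G\<close> plus
    \<open>\<rho> ^ r\<close> times that of \<open>A\<close>. The gap yields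
    \<open>d * c * real N\<close>, half of which the error consumes.\<close>
  with c(2) eventually_gt_at_top[of 0]
  have "\<forall>\<^sub>F N in sequentially. d * c / 2 * real N \<le> real (card (G \<inter> {..<N}))"
  proof eventually_elim
    case (elim N)
    let ?A = "A \<inter> {..<N}" and ?G = "G \<inter> {..<N}"
    have card: "(\<Sum>m<N. indicator A m :: real) = real (card ?A)"
      by (simp add: sum.If_cases indicator_def Int_commute)
    have "(\<Sum>m<N. indicator A m * of_real (f m)) - of_real \<kappa> * (\<Sum>m<N. indicator A m :: complex)
        = of_real ((\<Sum>m<N. indicator A m * f m) - \<kappa> * real (card ?A))"
      by (simp add: card[symmetric] indicator_def of_real_sum if_distrib cong: if_cong)
    then have "\<bar>(\<Sum>m<N. indicator A m * f m) - \<kappa> * real (card ?A)\<bar> / real N < d * c / 2"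
      using elim(3) by (simp add: norm_divide del: of_real_diff of_real_mult of_real_add)
    then have "\<bar>(\<Sum>m<N. indicator A m * f m) - \<kappa> * real (card ?A)\<bar> < d * c / 2 * real N"
      using elim(2) by (simp add: field_simps)
    then have "\<kappa> * real (card ?A) - d * c / 2 * real N < (\<Sum>m<N. indicator A m * f m)"
      by linarith
    moreover have "(\<Sum>m<N. indicator A m * f m) \<le> real (card ?G) + \<rho> ^ r * real (card ?A)"
    proof -
      have "(\<Sum>m<N. indicator A m * f m) \<le> (\<Sum>m<N. indicator G m + \<rho> ^ r * indicator A m)"
      proof (intro sum_mono)
        fix m
        show "indicator A m * f m \<le> indicator G m + \<rho> ^ r * indicator A m"
          using f_le1[of m] f_le[of m] \<rho>
          by (cases "cmod (z ^ m - a) < \<delta>") (auto simp: indicator_def G_def intro: add_increasing2)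
      qed
      also have "\<dots> = real (card ?G) + \<rho> ^ r * real (card ?A)"
        by (simp add: sum.distrib sum_distrib_left[symmetric] card)
           (simp add: sum.If_cases indicator_def Int_commute)
      finally show ?thesis .
    qed
    moreover have "d * (c * real N) \<le> (\<kappa> - \<rho> ^ r) * real (card ?A)"
      using d elim(1) c(1) by (intro mult_mono) auto
    ultimately show ?case by (simp add: algebra_simps)
  qed
  then show ?thesis
    unfolding pos_lower_density_iff G_def[symmetric] using c(1) d(1)
    by (intro exI[of _ "d * c / 2"]) auto
qed

section \<open>Simultaneous returns for finitely many points\<close>

text \<open>Asks for positive lower density of the returns, not for an exact frequency. For empty
  \<open>Z\<close> it says that every \<open>A j\<close> has positive lower density, which starts
  the construction.\<close>

definition equidistributed_along :: "(nat \<Rightarrow> nat set) \<Rightarrow> complex set \<Rightarrow> bool" where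
  "equidistributed_along A Z \<longleftrightarrow> (\<forall>j a \<delta>. (\<forall>z\<in>Z. cmod (a z) = 1) \<longrightarrow> \<delta> > 0 \<longrightarrow>
     pos_lower_density {m\<in>A j. \<forall>z\<in>Z. cmod (z ^ m - a z) < \<delta>})"

lemma equidistributed_alongD:
  assumes "equidistributed_along A Z" "\<And>z. z \<in> Z \<Longrightarrow> cmod (a z) = 1" "\<delta> > 0"
  shows "pos_lower_density {m\<in>A j. \<forall>z\<in>Z. cmod (z ^ m - a z) < \<delta>}"
  using assms unfolding equidistributed_along_def by blast

text \<open>Phases from a countable dense set \<open>D\<close> and tolerances
  \<open>1 / real (Suc k)\<close> give countably many return sets \<open>B j a k\<close>. For almost
  every \<open>z\<close> Weyl's averages vanish along all of them, so \<open>z ^ m\<close> returns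
  to any phase within each set of positive lower density among them.\<close>

lemma AE_equidistributed_along_insert:
  assumes Z: "finite Z" and eq: "equidistributed_along A Z"
  shows "AE z in lambda_T. cmod z = 1 \<longrightarrow> equidistributed_along A (insert z Z)"
proof -
  obtain D :: "complex set" where D: "countable D" "D \<subseteq> sphere 0 1" "sphere 0 1 \<subseteq> closure D"
    using separable[of "sphere 0 1 :: complex set"] by blast
  define B where "B j a k = {m\<in>A j. \<forall>z\<in>Z. cmod (z ^ m - a z) < 1 / real (Suc k)}" for j a k
  have cnt: "countable (Z \<rightarrow>\<^sub>E D)" using Z D(1) by (intro countable_PiE) auto
  have "AE z in lambda_T. \<forall>a\<in>Z \<rightarrow>\<^sub>E D. \<forall>j k n. cmod z = 1 \<longrightarrow>
      (\<lambda>N. (\<Sum>m<N. indicator (B j a k) m * z ^ (Suc n * m)) / of_nat N) \<longlonglongrightarrow> 0"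
    unfolding AE_ball_countable[OF cnt] AE_all_countable
    by (intro ballI allI AE_lambda_T_averages_tendsto_zero) (auto simp: indicator_def)
  then show ?thesis
  proof eventually_elim
    case (elim z)
    show ?case
    proof
      assume z: "cmod z = 1"
      show "equidistributed_along A (insert z Z)"
        unfolding equidistributed_along_def
      proof (intro allI impI)
        fix j a and \<delta> :: real
        assume a: "\<forall>z\<in>insert z Z. cmod (a z) = 1" and \<delta>: "\<delta> > 0"
        obtain k where k: "1 / real (Suc k) < \<delta> / 2"
          using \<delta> reals_Archimedean[of "\<delta> / 2"] by (auto simp: inverse_eq_divide)
        have "\<exists>d. d \<in> D \<and> cmod (d - a y) < \<delta> / 2" if "y \<in> Z" for y
        proof -
          have "a y \<in> closure D" using a D(3) that by auto
          then show ?thesis using \<delta> closure_approachableD[of "a y" D "\<delta> / 2"] by (auto simp: dist_norm norm_minus_commute)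
        qed
        then obtain d where d: "\<And>y. y \<in> Z \<Longrightarrow> d y \<in> D \<and> cmod (d y - a y) < \<delta> / 2" by metis
        \<comment> \<open>The restriction makes the phases an element of the countable set
          \<open>Z \<rightarrow>\<^sub>E D\<close>, for which the exceptional null sets were
          discarded.\<close>
        define a' where "a' = restrict d Z"
        have a': "a' \<in> Z \<rightarrow>\<^sub>E D" using d by (auto simp: a'_def)
        have "pos_lower_density (B j a' k)"
          unfolding B_def
        proof (rule equidistributed_alongD[OF eq])
          fix y assume "y \<in> Z"
          then have "d y \<in> sphere 0 1" using D(2) d by blast
          then show "cmod (a' y) = 1" using \<open>y \<in> Z\<close> by (simp add: a'_def)
        qed simp
        moreover have "(\<lambda>N. (\<Sum>m<N. indicator (B j a' k) m * z ^ (n * m)) / of_nat N) \<longlonglongrightarrow> 0"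
          if "n \<ge> 1" for n
          using elim a' z that by (cases n) auto
        ultimately have "pos_lower_density {m\<in>B j a' k. cmod (z ^ m - a z) < \<delta>}"
          using z a \<delta> by (intro pos_lower_density_return) auto
        moreover have "cmod (y ^ m - a y) < \<delta>" if "m \<in> B j a' k" "y \<in> Z" for m y
        proof -
          have "cmod (y ^ m - d y) < \<delta> / 2" using that k by (auto simp: B_def a'_def)
          then show ?thesis
            using d[OF that(2)] norm_triangle_ineq[of "y ^ m - d y" "d y - a y"] by simp
        qed
        ultimately show "pos_lower_density {m\<in>A j. \<forall>z\<in>insert z Z. cmod (z ^ m - a z) < \<delta>}"
          by (rule_tac pos_lower_density_mono) (auto simp: B_def)
      qed
    qed
  qed
qed

section \<open>Asymptotically orthogonal orbits and the choice of generic points\<close>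

text \<open>The Besicovitch inner product of the two sequences of powers vanishes.\<close>

definition orthogonal_orbits :: "complex \<Rightarrow> complex \<Rightarrow> bool" where
  "orthogonal_orbits z w \<longleftrightarrow> (\<lambda>N. (\<Sum>m<N. z ^ m * cnj (w ^ m)) / of_nat N) \<longlonglongrightarrow> 0"

lemma orthogonal_orbits_sym:
  assumes "orthogonal_orbits z w"
  shows "orthogonal_orbits w z"
  using tendsto_cnj[OF assms[unfolded orthogonal_orbits_def]]
  by (simp add: orthogonal_orbits_def mult.commute)

text \<open>Shows that a point whose orbit is orthogonal to those of the points already chosen is a
  new point.\<close>

lemma not_orthogonal_orbits_self:
  assumes "cmod z = 1"
  shows "\<not> orthogonal_orbits z z"
proof
  assume "orthogonal_orbits z z"
  moreover have "z ^ m * cnj (z ^ m) = 1" for m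
    using complex_norm_square[of "z ^ m"] assms by (simp add: norm_power)
  ultimately have "(\<lambda>N. of_nat N / of_nat N :: complex) \<longlonglongrightarrow> 0"
    by (simp add: orthogonal_orbits_def)
  moreover have "(\<lambda>N. of_nat N / of_nat N :: complex) \<longlonglongrightarrow> 1"
    by (rule tendsto_eventually) (use eventually_gt_at_top[of 0] in eventually_elim, simp)
  ultimately show False using LIMSEQ_unique zero_neq_one by blast
qed

lemma AE_orthogonal_orbits:
  assumes "finite W" "W \<subseteq> sphere 0 1"
  shows "AE z in lambda_T. cmod z = 1 \<longrightarrow> (\<forall>w\<in>W. orthogonal_orbits z w)"
proof -
  have "AE z in lambda_T. \<forall>w\<in>W. cmod z = 1 \<longrightarrow> orthogonal_orbits z w"
  proof (rule AE_finite_allI[OF assms(1)])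
    fix w assume "w \<in> W"
    then have "cmod (cnj (w ^ m)) \<le> 1" for m using assms(2) by (auto simp: norm_power)
    from AE_lambda_T_averages_tendsto_zero[of 1 "\<lambda>m. cnj (w ^ m)", OF _ this]
    show "AE z in lambda_T. cmod z = 1 \<longrightarrow> orthogonal_orbits z w"
      by (simp add: orthogonal_orbits_def mult.commute)
  qed
  then show ?thesis by eventually_elim auto
qed

text \<open>The points are added one at a time. Each step has to avoid only a null set, and
  \<open>S\<close> is not contained in one; negligibility is phrased by \<open>AE\<close>, so
  \<open>S\<close> may be any subset of the circle.\<close>

lemma exists_equidistributed_points:
  assumes S: "\<not> (AE z in lambda_T. z \<notin> S)" "S \<subseteq> sphere 0 1"
    and Z: "finite Z" "Z \<subseteq> sphere 0 1" "equidistributed_along A Z"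
  shows "\<exists>Z'. finite Z' \<and> card Z' = K \<and> Z' \<subseteq> S \<and> Z \<inter> Z' = {} \<and> equidistributed_along A (Z \<union> Z') \<and>
           (\<forall>z\<in>Z'. \<forall>w\<in>Z'. z \<noteq> w \<longrightarrow> orthogonal_orbits z w)"
proof (induction K)
  case 0
  then show ?case using Z by (intro exI[of _ "{}"]) auto
next
  case (Suc K)
  then obtain Z' where Z': "finite Z'" "card Z' = K" "Z' \<subseteq> S" "Z \<inter> Z' = {}"
    "equidistributed_along A (Z \<union> Z')" "\<forall>z\<in>Z'. \<forall>w\<in>Z'. z \<noteq> w \<longrightarrow> orthogonal_orbits z w"
    by blast
  have "finite (Z \<union> Z')" "Z \<union> Z' \<subseteq> sphere 0 1" using Z Z' S by auto
  then have ae: "AE z in lambda_T. cmod z = 1 \<longrightarrow>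
      equidistributed_along A (insert z (Z \<union> Z')) \<and> (\<forall>w\<in>Z \<union> Z'. orthogonal_orbits z w)"
    using AE_equidistributed_along_insert[OF _ Z'(5)] AE_orthogonal_orbits[of "Z \<union> Z'"]
    by (auto elim: AE_mp)
  obtain z where z: "z \<in> S" "equidistributed_along A (insert z (Z \<union> Z'))"
    "\<forall>w\<in>Z \<union> Z'. orthogonal_orbits z w"
  proof (rule ccontr)
    assume "\<not> thesis"
    with that S(2) have "\<forall>z\<in>S. cmod z = 1 \<and> \<not> (equidistributed_along A (insert z (Z \<union> Z')) \<and>
        (\<forall>w\<in>Z \<union> Z'. orthogonal_orbits z w))" by auto
    with ae have "AE z in lambda_T. z \<notin> S" by (auto elim!: eventually_mono)
    with S(1) show False by blast
  qed
  have "cmod z = 1" using z S by auto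
  then have "z \<notin> Z \<union> Z'" using z(3) not_orthogonal_orbits_self by blast
  then show ?case
    using Z' z by (intro exI[of _ "insert z Z'"]) (auto intro: orthogonal_orbits_sym)
qed

text \<open>By orthogonality the mean square tends to \<open>1 / card Z\<close>, hence is eventually
  below \<open>2 / card Z\<close>, which is at most \<open>\<eta>\<^sup>2\<close>.\<close>

lemma average_norm_mean_le:
  assumes Z: "finite Z" "Z \<subseteq> sphere 0 1"
    and orth: "\<And>z w. z \<in> Z \<Longrightarrow> w \<in> Z \<Longrightarrow> z \<noteq> w \<Longrightarrow> orthogonal_orbits z w"
    and card: "0 < \<eta>" "2 / \<eta>\<^sup>2 \<le> real (card Z)"
  shows "\<forall>\<^sub>F N in sequentially. (\<Sum>m<N. cmod ((\<Sum>z\<in>Z. z ^ m) / of_nat (card Z))) \<le> \<eta> * real N"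
proof -
  define K where "K = card Z"
  have K: "real K > 0" using card by (smt (verit) K_def divide_pos_pos zero_less_power)
  define s where "s m = cmod (\<Sum>z\<in>Z. 1 / of_nat K * z ^ m)" for m
  have "(\<lambda>N. ((\<Sum>m<N. 1 * of_real ((s m)\<^sup>2)) - of_real (\<Sum>z\<in>Z. (cmod (1 / of_nat K))\<^sup>2) * (\<Sum>m<N. 1 :: complex))
      / of_nat N) \<longlonglongrightarrow> 0"
    unfolding s_def using Z orth
    by (intro average_norm_square_sum) (auto simp: orthogonal_orbits_def norm_power)
  moreover have "(\<Sum>z\<in>Z. (cmod (1 / of_nat K))\<^sup>2) = 1 / real K"
    using K by (simp add: norm_divide K_def[symmetric] power2_eq_square)
  ultimately have "(\<lambda>N. ((\<Sum>m<N. 1 * of_real ((s m)\<^sup>2)) - of_real (1 / real K) * (\<Sum>m<N. 1 :: complex))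
      / of_nat N) \<longlonglongrightarrow> 0" by (simp only:)
  then have "\<forall>\<^sub>F N in sequentially. dist (((\<Sum>m<N. 1 * of_real ((s m)\<^sup>2)) - of_real (1 / real K) * (\<Sum>m<N. 1 :: complex))
      / of_nat N) 0 < 1 / real K"
    by (rule tendstoD) (use K in auto)
  with eventually_gt_at_top[of 0] show ?thesis
  proof eventually_elim
    case (elim N)
    have "((\<Sum>m<N. 1 * of_real ((s m)\<^sup>2)) - of_real (1 / real K) * (\<Sum>m<N. 1 :: complex)) / of_nat N
        = of_real (((\<Sum>m<N. (s m)\<^sup>2) - real N / real K) / real N)" by simp
    with elim(2) have "\<bar>((\<Sum>m<N. (s m)\<^sup>2) - real N / real K) / real N\<bar> < 1 / real K"
      by (simp only: dist_0_norm dist_commute norm_of_real)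
    then have "((\<Sum>m<N. (s m)\<^sup>2) - real N / real K) / real N < 1 / real K" by linarith
    then have sq: "(\<Sum>m<N. (s m)\<^sup>2) < 2 / real K * real N"
      using elim(1) K by (simp add: field_simps)
    have K\<eta>: "2 / real K \<le> \<eta>\<^sup>2"
      using card K by (simp add: K_def[symmetric] field_simps)
    \<comment> \<open>Passes from mean squares to means; the weight \<open>\<eta>\<close> balances
      the two terms, each contributing \<open>\<eta> / 2\<close>.\<close>
    have amgm: "s m \<le> (s m)\<^sup>2 / (2 * \<eta>) + \<eta> / 2" for m
    proof -
      have "0 \<le> (s m - \<eta>)\<^sup>2" by simp
      then show ?thesis using card(1) by (simp add: field_simps power2_eq_square)
    qed
    have "(\<Sum>m<N. s m) \<le> (\<Sum>m<N. (s m)\<^sup>2 / (2 * \<eta>) + \<eta> / 2)" by (intro sum_mono amgm)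
    also have "\<dots> = (\<Sum>m<N. (s m)\<^sup>2) / (2 * \<eta>) + \<eta> / 2 * real N"
      by (simp add: sum.distrib sum_divide_distrib)
    also have "(\<Sum>m<N. (s m)\<^sup>2) / (2 * \<eta>) \<le> \<eta>\<^sup>2 * real N / (2 * \<eta>)"
      using sq mult_right_mono[OF K\<eta>, of "real N"] card(1) by (intro divide_right_mono) auto
    also have "\<eta>\<^sup>2 * real N / (2 * \<eta>) = \<eta> / 2 * real N"
      using card(1) by (simp add: power2_eq_square)
    finally have "(\<Sum>m<N. s m) \<le> \<eta> * real N" by (simp add: algebra_simps)
    then show ?case by (simp add: s_def K_def sum_divide_distrib)
  qed
qed

section \<open>Approximation of vectors by sums of eigenvectors with small orbit averages\<close>

locale complex_operator =
  fixes sc :: "complex \<Rightarrow> 'a::banach \<Rightarrow> 'a" and T :: "'a \<Rightarrow> 'a"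
  assumes complex_structure: "complex_structure sc"
    and bounded_linear_T: "bounded_linear T"
    and T_sc: "T (sc c x) = sc c (T x)"
begin

lemma sc_simps:
  "sc (a + b) x = sc a x + sc b x" "sc a (x + y) = sc a x + sc a y"
  "sc (a * b) x = sc a (sc b x)" "sc (complex_of_real r) x = r *\<^sub>R x"
  "norm (sc a x) = cmod a * norm x"
  using complex_structure by (auto simp: complex_structure_def)

lemma sc_one [simp]: "sc 1 x = x"
  using sc_simps(4)[of 1 x] by simp

lemma sc_scaleR: "sc a (r *\<^sub>R x) = r *\<^sub>R sc a x"
  using sc_simps(3)[of a "of_real r" x] sc_simps(3)[of "of_real r" a x]
  by (simp add: sc_simps(4) mult.commute)

lemma linear_sc: "linear (sc a)"
  by (rule linearI) (simp_all add: sc_simps sc_scaleR)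

lemma linear_sc_left: "linear (\<lambda>a. sc a x)"
proof (rule linearI)
  show "sc (r *\<^sub>R a) x = r *\<^sub>R sc a x" for r a
    using sc_simps(3)[of "of_real r" a x] by (simp add: sc_simps(4) scaleR_conv_of_real)
qed (simp add: sc_simps)

lemmas sc_sum = linear_sum[OF linear_sc]
lemmas sc_sum_left = linear_sum[OF linear_sc_left]
lemmas sc_diff = linear_diff[OF linear_sc]

lemma bounded_linear_funpow: "bounded_linear (T ^^ m)"
proof (induction m)
  case (Suc m)
  then show ?case using bounded_linear_compose[OF bounded_linear_T Suc] by (simp add: o_def)
qed (simp add: id_def bounded_linear_ident)

lemmas linear_funpow = bounded_linear.linear[OF bounded_linear_funpow]
lemmas funpow_sum = linear_sum[OF linear_funpow]
lemmas funpow_add_right = linear_add[OF linear_funpow]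
lemmas funpow_diff = linear_diff[OF linear_funpow]

lemma funpow_eigenvector:
  assumes "T e = sc z e"
  shows "(T ^^ m) e = sc (z ^ m) e"
  by (induction m) (simp_all add: T_sc assms flip: sc_simps(3), simp add: mult.commute)

text \<open>The sum is close to \<open>w\<close> at time 0, yet its orbit is small on average; the
  last sum is the orbit at time \<open>m\<close>. The eigenvalues are new with respect to
  \<open>Z\<close> and stay jointly generic with it.\<close>

definition eigenvector_sum_approximation ::
    "(nat \<Rightarrow> nat set) \<Rightarrow> real \<Rightarrow> complex set \<Rightarrow> 'a \<Rightarrow> complex set \<Rightarrow> (complex \<Rightarrow> 'a) \<Rightarrow> bool" where
  "eigenvector_sum_approximation A \<epsilon> Z w Z' e \<longleftrightarrow>
     finite Z' \<and> Z' \<subseteq> sphere 0 1 \<and> Z \<inter> Z' = {} \<and> equidistributed_along A (Z \<union> Z') \<and>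
     (\<forall>z\<in>Z'. T (e z) = sc z (e z)) \<and> norm ((\<Sum>z\<in>Z'. e z) - w) < \<epsilon> \<and>
     (\<forall>\<^sub>F N in sequentially. (\<Sum>m<N. norm (\<Sum>z\<in>Z'. sc (z ^ m) (e z))) \<le> \<epsilon> * real N)"

text \<open>Quantifying over all finite sets \<open>Z\<close> of eigenvalues already in use is what
  allows approximations to be added and the construction to be iterated.\<close>

definition approximable :: "(nat \<Rightarrow> nat set) \<Rightarrow> 'a \<Rightarrow> bool" where
  "approximable A w \<longleftrightarrow>
     (\<forall>\<epsilon> Z. \<epsilon> > 0 \<longrightarrow> finite Z \<longrightarrow> Z \<subseteq> sphere 0 1 \<longrightarrow> equidistributed_along A Z \<longrightarrow>
        (\<exists>Z' e. eigenvector_sum_approximation A \<epsilon> Z w Z' e))"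

lemma approximableE:
  assumes "approximable A w" "\<epsilon> > 0" "finite Z" "Z \<subseteq> sphere 0 1" "equidistributed_along A Z"
  obtains Z' e where "eigenvector_sum_approximation A \<epsilon> Z w Z' e"
  using assms unfolding approximable_def by blast

lemma approximableI:
  assumes "\<And>\<epsilon> Z. \<epsilon> > 0 \<Longrightarrow> finite Z \<Longrightarrow> Z \<subseteq> sphere 0 1 \<Longrightarrow> equidistributed_along A Z \<Longrightarrow>
     \<exists>Z' e. eigenvector_sum_approximation A \<epsilon> Z w Z' e"
  shows "approximable A w"
  using assms unfolding approximable_def by blast

lemma eigenvector_sum_approximationD:
  assumes "eigenvector_sum_approximation A \<epsilon> Z w Z' e"
  shows "finite Z'" "Z' \<subseteq> sphere 0 1" "Z \<inter> Z' = {}" "equidistributed_along A (Z \<union> Z')"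
    "\<forall>z\<in>Z'. T (e z) = sc z (e z)" "norm ((\<Sum>z\<in>Z'. e z) - w) < \<epsilon>"
    "\<forall>\<^sub>F N in sequentially. (\<Sum>m<N. norm (\<Sum>z\<in>Z'. sc (z ^ m) (e z))) \<le> \<epsilon> * real N"
  using assms unfolding eigenvector_sum_approximation_def by blast+

lemma approximable_zero: "approximable A 0"
  by (rule approximableI, rule exI[of _ "{}"]) (auto simp: eigenvector_sum_approximation_def)

text \<open>The second vector is approximated relative to \<open>Z \<union> Y\<close>, where
  \<open>Y\<close> serves the first. The two sets of eigenvalues are then disjoint and jointly
  generic.\<close>

lemma approximable_add:
  assumes "approximable A v" "approximable A w"
  shows "approximable A (v + w)"
proof (rule approximableI)
  fix \<epsilon> :: real and Z
  assume \<epsilon>: "\<epsilon> > 0" and Z: "finite Z" "Z \<subseteq> sphere 0 1" "equidistributed_along A Z"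
  have \<epsilon>2: "\<epsilon> / 2 > 0" using \<epsilon> by simp
  obtain Y d where "eigenvector_sum_approximation A (\<epsilon> / 2) Z v Y d"
    by (rule approximableE[OF assms(1) \<epsilon>2 Z])
  note Y = eigenvector_sum_approximationD[OF this]
  have ZY: "finite (Z \<union> Y)" "Z \<union> Y \<subseteq> sphere 0 1" using Z Y by auto
  obtain W e where "eigenvector_sum_approximation A (\<epsilon> / 2) (Z \<union> Y) w W e"
    by (rule approximableE[OF assms(2) \<epsilon>2 ZY Y(4)])
  note W = eigenvector_sum_approximationD[OF this]
  define f where "f z = (if z \<in> Y then d z else e z)" for z
  have disj: "Y \<inter> W = {}" using W(3) by auto
  have split: "(\<Sum>z\<in>Y \<union> W. h z (f z)) = (\<Sum>z\<in>Y. h z (d z)) + (\<Sum>z\<in>W. h z (e z))"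
    for h :: "complex \<Rightarrow> 'a \<Rightarrow> 'a"
  proof -
    have "(\<Sum>z\<in>W. h z (f z)) = (\<Sum>z\<in>W. h z (e z))"
      using disj by (intro sum.cong) (auto simp: f_def)
    then show ?thesis using Y(1) W(1) disj by (simp add: sum.union_disjoint f_def)
  qed
  have "norm ((\<Sum>z\<in>Y \<union> W. f z) - (v + w)) < \<epsilon>"
    using split[of "\<lambda>_ x. x"] Y(6) W(6)
      norm_triangle_ineq[of "(\<Sum>z\<in>Y. d z) - v" "(\<Sum>z\<in>W. e z) - w"]
    by (simp add: algebra_simps)
  moreover have "\<forall>\<^sub>F N in sequentially. (\<Sum>m<N. norm (\<Sum>z\<in>Y \<union> W. sc (z ^ m) (f z))) \<le> \<epsilon> * real N"
    using Y(7) W(7)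
  proof eventually_elim
    case (elim N)
    have "(\<Sum>m<N. norm (\<Sum>z\<in>Y \<union> W. sc (z ^ m) (f z)))
        \<le> (\<Sum>m<N. norm (\<Sum>z\<in>Y. sc (z ^ m) (d z)) + norm (\<Sum>z\<in>W. sc (z ^ m) (e z)))"
    proof (rule sum_mono)
      fix m
      show "norm (\<Sum>z\<in>Y \<union> W. sc (z ^ m) (f z))
          \<le> norm (\<Sum>z\<in>Y. sc (z ^ m) (d z)) + norm (\<Sum>z\<in>W. sc (z ^ m) (e z))"
        unfolding split[of "\<lambda>z. sc (z ^ m)"] by (rule norm_triangle_ineq)
    qed
    then show ?case using elim by (simp add: sum.distrib)
  qed
  moreover have "\<forall>z\<in>Y \<union> W. T (f z) = sc z (f z)" using Y(5) W(5) by (auto simp: f_def)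
  moreover have "finite (Y \<union> W)" "Y \<union> W \<subseteq> sphere 0 1" "Z \<inter> (Y \<union> W) = {}"
      "equidistributed_along A (Z \<union> (Y \<union> W))"
    using Y(1-3) W(1-4) by (auto simp: Un_assoc)
  ultimately have "eigenvector_sum_approximation A \<epsilon> Z (v + w) (Y \<union> W) f"
    unfolding eigenvector_sum_approximation_def by (intro conjI)
  then show "\<exists>Z' e. eigenvector_sum_approximation A \<epsilon> Z (v + w) Z' e" by blast
qed

lemma approximable_sc:
  assumes "approximable A w"
  shows "approximable A (sc c w)"
proof (rule approximableI)
  fix \<epsilon> :: real and Z
  assume \<epsilon>: "\<epsilon> > 0" and Z: "finite Z" "Z \<subseteq> sphere 0 1" "equidistributed_along A Z"
  \<comment> \<open>The added 1 covers \<open>c = 0\<close>.\<close>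
  define \<eta> where "\<eta> = \<epsilon> / (cmod c + 1)"
  have \<eta>: "\<eta> > 0" using \<epsilon> by (simp add: \<eta>_def add_nonneg_pos)
  have "cmod c * \<epsilon> \<le> (cmod c + 1) * \<epsilon>" using \<epsilon> by simp
  then have c\<eta>: "cmod c * \<eta> \<le> \<epsilon>"
    by (simp add: \<eta>_def pos_divide_le_eq add_nonneg_pos mult.commute)
  have c\<eta>': "cmod c * x < \<epsilon>" if "x < \<eta>" "0 \<le> x" for x
  proof -
    have "(cmod c + 1) * x < (cmod c + 1) * \<eta>" using that by (intro mult_strict_left_mono) (auto simp: add_nonneg_pos)
    moreover have "(cmod c + 1) * \<eta> = \<epsilon>"
    proof -
      have "cmod c + 1 \<noteq> 0" using norm_ge_zero[of c] by linarith
      then show ?thesis by (simp add: \<eta>_def)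
    qed
    ultimately show ?thesis using that by (simp add: distrib_right)
  qed
  obtain W e where "eigenvector_sum_approximation A \<eta> Z w W e"
    by (rule approximableE[OF assms \<eta> Z])
  note W = eigenvector_sum_approximationD[OF this]
  have "norm ((\<Sum>z\<in>W. sc c (e z)) - sc c w) < \<epsilon>"
    using c\<eta>'[OF W(6)] by (simp add: sc_sum[symmetric] sc_diff[symmetric] sc_simps(5))
  moreover have "\<forall>\<^sub>F N in sequentially. (\<Sum>m<N. norm (\<Sum>z\<in>W. sc (z ^ m) (sc c (e z)))) \<le> \<epsilon> * real N"
    using W(7)
  proof eventually_elim
    case (elim N)
    have "(\<Sum>z\<in>W. sc (z ^ m) (sc c (e z))) = sc c (\<Sum>z\<in>W. sc (z ^ m) (e z))" for m
      by (simp add: sc_sum sc_simps(3)[symmetric] mult.commute)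
    then have "(\<Sum>m<N. norm (\<Sum>z\<in>W. sc (z ^ m) (sc c (e z))))
        = cmod c * (\<Sum>m<N. norm (\<Sum>z\<in>W. sc (z ^ m) (e z)))"
      by (simp add: sc_simps(5) sum_distrib_left)
    also have "\<dots> \<le> cmod c * (\<eta> * real N)" using elim by (intro mult_left_mono) auto
    also have "\<dots> \<le> \<epsilon> * real N" using mult_right_mono[OF c\<eta>, of "real N"] by (simp add: mult_ac)
    finally show ?case .
  qed
  moreover have "\<forall>z\<in>W. T (sc c (e z)) = sc z (sc c (e z))"
    using W(5) by (simp add: T_sc sc_simps(3)[symmetric] mult.commute)
  moreover note W(1-5)
  ultimately have "eigenvector_sum_approximation A \<epsilon> Z (sc c w) W (\<lambda>z. sc c (e z))"
    unfolding eigenvector_sum_approximation_def by (intro conjI)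
  then show "\<exists>Z' e. eigenvector_sum_approximation A \<epsilon> Z (sc c w) Z' e" by blast
qed

text \<open>Only the closeness condition mentions the target vector, so an approximation of a nearby
  vector serves.\<close>

lemma approximable_closure:
  assumes "w \<in> closure {v. approximable A v}"
  shows "approximable A w"
proof (rule approximableI)
  fix \<epsilon> :: real and Z
  assume \<epsilon>: "\<epsilon> > 0" and Z: "finite Z" "Z \<subseteq> sphere 0 1" "equidistributed_along A Z"
  have \<epsilon>2: "\<epsilon> / 2 > 0" using \<epsilon> by simp
  obtain v where v: "approximable A v" "dist v w < \<epsilon> / 2"
    using closure_approachableD[OF assms \<epsilon>2] by (auto simp: dist_commute)
  obtain W e where "eigenvector_sum_approximation A (\<epsilon> / 2) Z v W e"
    by (rule approximableE[OF v(1) \<epsilon>2 Z])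
  note W = eigenvector_sum_approximationD[OF this]
  have "norm ((\<Sum>z\<in>W. e z) - w) < \<epsilon>"
    using W(6) v(2) norm_triangle_ineq[of "(\<Sum>z\<in>W. e z) - v" "v - w"] by (simp add: dist_norm)
  moreover have "\<forall>\<^sub>F N in sequentially. (\<Sum>m<N. norm (\<Sum>z\<in>W. sc (z ^ m) (e z))) \<le> \<epsilon> * real N"
    using W(7)
  proof eventually_elim
    case (elim N)
    have "\<epsilon> / 2 * real N \<le> \<epsilon> * real N" using \<epsilon> by (intro mult_right_mono) auto
    then show ?case using elim by linarith
  qed
  moreover note W(1-5)
  ultimately have "eigenvector_sum_approximation A \<epsilon> Z w W e"
    unfolding eigenvector_sum_approximation_def by (intro conjI)
  then show "\<exists>Z' e. eigenvector_sum_approximation A \<epsilon> Z w Z' e" by blast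
qed

text \<open>Averaging \<open>E\<close> over many generic points near \<open>\<zeta>\<close> changes \<open>E \<zeta>\<close> only slightly, but the orbit
of the average is small in the mean because the powers of the points are asymptotically orthogonal.\<close>
lemma approximable_eigenvector_field:
  assumes E: "\<And>z. z \<in> sphere 0 1 \<Longrightarrow> T (E z) = sc z (E z)"
    and ess: "\<And>\<delta>. \<delta> > 0 \<Longrightarrow> \<not> (AE z in lambda_T. z \<notin> {z \<in> sphere 0 1. norm (E z - E \<zeta>) < \<delta>})"
  shows "approximable A (E \<zeta>)"
proof (rule approximableI)
  fix \<epsilon> :: real and Z
  assume \<epsilon>: "\<epsilon> > 0" and Z: "finite Z" "Z \<subseteq> sphere 0 1" "equidistributed_along A Z"
  define S where "S = {z \<in> sphere 0 1. norm (E z - E \<zeta>) < \<epsilon> / 2}"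
  define \<eta> where "\<eta> = \<epsilon> / (2 * (norm (E \<zeta>) + 1))"
  have pos: "norm (E \<zeta>) + 1 > 0" by (simp add: add_nonneg_pos)
  have \<eta>: "\<eta> > 0" using \<epsilon> pos by (simp add: \<eta>_def)
  have \<eta>E: "\<eta> * norm (E \<zeta>) \<le> \<epsilon> / 2"
  proof -
    have "\<eta> * norm (E \<zeta>) \<le> \<eta> * (norm (E \<zeta>) + 1)" using \<eta> by simp
    also have "\<dots> = \<epsilon> / 2"
    proof -
      have "\<epsilon> / (2 * p) * p = \<epsilon> / 2" if "p > 0" for p :: real using that by simp
      then show ?thesis unfolding \<eta>_def using pos .
    qed
    finally show ?thesis .
  qed
  \<comment> \<open>Enough points for the mean of their powers to have average modulus at most
    \<open>\<eta>\<close>.\<close>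
  obtain K :: nat where K: "2 / \<eta>\<^sup>2 \<le> real K" using real_arch_simple by blast
  have S_sub: "S \<subseteq> sphere 0 1" by (auto simp: S_def)
  have "\<not> (AE z in lambda_T. z \<notin> S)" unfolding S_def by (rule ess) (use \<epsilon> in simp)
  then obtain W where W: "finite W" "card W = K" "W \<subseteq> S" "Z \<inter> W = {}" "equidistributed_along A (Z \<union> W)"
      "\<forall>z\<in>W. \<forall>w\<in>W. z \<noteq> w \<longrightarrow> orthogonal_orbits z w"
    using exists_equidistributed_points[OF _ _ Z, of S K] S_sub by blast
  have WT: "W \<subseteq> sphere 0 1" using W(3) by (auto simp: S_def)
  have "2 / \<eta>\<^sup>2 > 0" using \<eta> by simp
  then have K0: "real K > 0" using K by linarith
  define e where "e z = (1 / real K) *\<^sub>R E z" for z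
  \<comment> \<open>Replacing every \<open>E z\<close> by \<open>E \<zeta>\<close> costs less than
    \<open>\<epsilon> / 2\<close> whatever the unimodular phases, hence uniformly along the
    orbit.\<close>
  have dev: "norm (\<Sum>z\<in>W. sc (u z) (e z - (1 / real K) *\<^sub>R E \<zeta>)) < \<epsilon> / 2"
    if "\<And>z. z \<in> W \<Longrightarrow> cmod (u z) = 1" for u
  proof -
    have "norm (\<Sum>z\<in>W. sc (u z) (e z - (1 / real K) *\<^sub>R E \<zeta>)) \<le> (\<Sum>z\<in>W. (1 / real K) * norm (E z - E \<zeta>))"
    proof (rule sum_norm_le)
      fix z assume "z \<in> W"
      have "e z - (1 / real K) *\<^sub>R E \<zeta> = (1 / real K) *\<^sub>R (E z - E \<zeta>)"
        by (simp add: e_def scaleR_diff_right)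
      then show "norm (sc (u z) (e z - (1 / real K) *\<^sub>R E \<zeta>)) \<le> (1 / real K) * norm (E z - E \<zeta>)"
        using that[OF \<open>z \<in> W\<close>] by (simp only: sc_simps(5)) simp
    qed
    also have "\<dots> < (\<Sum>z\<in>W. (1 / real K) * (\<epsilon> / 2))"
      using W K0 by (intro sum_strict_mono mult_strict_left_mono) (auto simp: S_def)
    also have "\<dots> = \<epsilon> / 2" using W(2) K0 by simp
    finally show ?thesis .
  qed
  have split: "(\<Sum>z\<in>W. sc (u z) (e z)) = sc ((\<Sum>z\<in>W. u z) / of_nat K) (E \<zeta>)
      + (\<Sum>z\<in>W. sc (u z) (e z - (1 / real K) *\<^sub>R E \<zeta>))" for u
  proof -
    have "(\<Sum>z\<in>W. sc (u z) ((1 / real K) *\<^sub>R E \<zeta>)) = sc ((\<Sum>z\<in>W. u z) * of_real (1 / real K)) (E \<zeta>)"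
      by (simp only: sc_simps(3) sc_simps(4) sc_sum_left)
    also have "(\<Sum>z\<in>W. u z) * of_real (1 / real K) = (\<Sum>z\<in>W. u z) / of_nat K" by simp
    finally show ?thesis by (simp add: sc_diff sum_subtractf)
  qed
  have "norm ((\<Sum>z\<in>W. e z) - E \<zeta>) < \<epsilon>"
    using split[of "\<lambda>_. 1"] dev[of "\<lambda>_. 1"] W(2) K0 \<epsilon> by simp
  moreover have "\<forall>\<^sub>F N in sequentially. (\<Sum>m<N. norm (\<Sum>z\<in>W. sc (z ^ m) (e z))) \<le> \<epsilon> * real N"
  proof -
    have "\<forall>\<^sub>F N in sequentially. (\<Sum>m<N. cmod ((\<Sum>z\<in>W. z ^ m) / of_nat (card W))) \<le> \<eta> * real N"
      using W WT \<eta> K by (intro average_norm_mean_le) auto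
    then show ?thesis
    proof eventually_elim
      case (elim N)
      have "(\<Sum>m<N. norm (\<Sum>z\<in>W. sc (z ^ m) (e z)))
          \<le> (\<Sum>m<N. cmod ((\<Sum>z\<in>W. z ^ m) / of_nat K) * norm (E \<zeta>) + \<epsilon> / 2)"
      proof (rule sum_mono)
        fix m
        have "norm (\<Sum>z\<in>W. sc (z ^ m) (e z - (1 / real K) *\<^sub>R E \<zeta>)) < \<epsilon> / 2"
          using WT by (intro dev) (auto simp: norm_power)
        then show "norm (\<Sum>z\<in>W. sc (z ^ m) (e z)) \<le> cmod ((\<Sum>z\<in>W. z ^ m) / of_nat K) * norm (E \<zeta>) + \<epsilon> / 2"
          unfolding split sc_simps(5)[symmetric] by (intro norm_triangle_le) linarith
      qed
      also have "\<dots> = (\<Sum>m<N. cmod ((\<Sum>z\<in>W. z ^ m) / of_nat K)) * norm (E \<zeta>) + \<epsilon> / 2 * real N"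
        by (simp add: sum.distrib sum_distrib_right)
      also have "\<dots> \<le> \<eta> * real N * norm (E \<zeta>) + \<epsilon> / 2 * real N"
        using elim W(2) by (intro add_right_mono mult_right_mono) auto
      also have "\<dots> \<le> \<epsilon> * real N"
        using mult_right_mono[OF \<eta>E, of "real N"] by (simp add: algebra_simps)
      finally show ?case .
    qed
  qed
  moreover have "\<forall>z\<in>W. T (e z) = sc z (e z)"
    using WT E linear_scale[OF bounded_linear.linear[OF bounded_linear_T]]
    by (auto simp: e_def sc_scaleR)
  moreover note W(1,4,5) WT
  ultimately have "eigenvector_sum_approximation A \<epsilon> Z (E \<zeta>) W e"
    unfolding eigenvector_sum_approximation_def by (intro conjI)
  then show "\<exists>Z' e. eigenvector_sum_approximation A \<epsilon> Z (E \<zeta>) Z' e" by blast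
qed

text \<open>Separability of the space makes almost every point \<open>\<zeta>\<close> one at which
  the value \<open>E i \<zeta>\<close> is approached on a non-negligible set, for all
  \<open>i\<close> at once. The spanning hypothesis, applied with the exceptional null set removed,
  then gives density.\<close>

lemma approximable_all:
  assumes sep: "separable_space_UNIV TYPE('a)" and I: "countable I"
    and E: "\<And>i. i \<in> I \<Longrightarrow> T_eigenvector_field sc T (E i)"
    and span: "lambda_spanning sc I E"
  shows "approximable A w"
proof -
  obtain D :: "'a set" where D: "countable D" "closure D = UNIV"
    using sep by (auto simp: separable_space_UNIV_def)
  define B where "B i d k = {z \<in> sphere 0 1. norm (E i z - d) < 1 / real (Suc k)}" for i d k
  \<comment> \<open>The negligible ones among the countably many sets \<open>B i d k\<close> are
    discarded together. A point outside \<open>N\<close> lies only in non-negligible ones.\<close>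
  have "AE z in lambda_T. \<forall>i\<in>I. \<forall>d\<in>D. \<forall>k. (AE z' in lambda_T. z' \<notin> B i d k) \<longrightarrow> z \<notin> B i d k"
    unfolding AE_ball_countable[OF I] AE_ball_countable[OF D(1)] AE_all_countable by auto
  then obtain N where N: "N \<in> null_sets lambda_T"
    "{z \<in> space lambda_T. \<not> (\<forall>i\<in>I. \<forall>d\<in>D. \<forall>k. (AE z' in lambda_T. z' \<notin> B i d k) \<longrightarrow> z \<notin> B i d k)} \<subseteq> N"
    unfolding eventually_ae_filter by blast
  have spc: "space lambda_T = UNIV" by (simp add: lambda_T_def)
  have base: "approximable A (E i \<zeta>)" if i: "i \<in> I" and \<zeta>: "\<zeta> \<in> sphere 0 1 - N" for i \<zeta>
  proof (rule approximable_eigenvector_field)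
    show "T (E i z) = sc z (E i z)" if "z \<in> sphere 0 1" for z
      using E[OF i] that by (auto simp: T_eigenvector_field_def)
    show "\<not> (AE z in lambda_T. z \<notin> {z \<in> sphere 0 1. norm (E i z - E i \<zeta>) < \<delta>})" if \<delta>: "\<delta> > 0" for \<delta>
    proof
      assume ae: "AE z in lambda_T. z \<notin> {z \<in> sphere 0 1. norm (E i z - E i \<zeta>) < \<delta>}"
      obtain k where k: "1 / real (Suc k) < \<delta> / 2"
        using \<delta> reals_Archimedean[of "\<delta> / 2"] by (auto simp: inverse_eq_divide)
      obtain d where d: "d \<in> D" "norm (E i \<zeta> - d) < 1 / real (Suc k)"
        using closure_approachableD[of "E i \<zeta>" D "1 / real (Suc k)"] D(2) by (auto simp: dist_norm)
      have "z \<in> {z \<in> sphere 0 1. norm (E i z - E i \<zeta>) < \<delta>}" if "z \<in> B i d k" for z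
        using that d(2) k norm_triangle_ineq[of "E i z - d" "d - E i \<zeta>"]
        by (auto simp: B_def norm_minus_commute)
      with ae have "AE z in lambda_T. z \<notin> B i d k" by (auto elim!: eventually_mono)
      moreover have "\<zeta> \<in> B i d k" using \<zeta> d(2) by (auto simp: B_def)
      ultimately have "\<zeta> \<in> N" using N(2) i d(1) spc by blast
      then show False using \<zeta> by blast
    qed
  qed
  \<comment> \<open>\<open>cspan_sc\<close> is a real span of complex multiples: the generators
    absorb the complex scalars, and the induction needs a real subspace.\<close>
  have "approximable A v"
    if "v \<in> cspan_sc sc {E i z | i z. i \<in> I \<and> z \<in> sphere 0 1 - N}" for v
    using that unfolding cspan_sc_def
  proof (induction rule: span_induct)
    show "subspace {v. approximable A v}"
      using approximable_sc[of A _ "of_real _"]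
      by (auto simp: subspace_def approximable_zero approximable_add sc_simps(4))
  qed (auto intro!: approximable_sc base)
  then have "closure (cspan_sc sc {E i z | i z. i \<in> I \<and> z \<in> sphere 0 1 - N}) \<subseteq> closure {v. approximable A v}"
    by (intro closure_mono) blast
  moreover have "closure (cspan_sc sc {E i z | i z. i \<in> I \<and> z \<in> sphere 0 1 - N}) = UNIV"
    using span N(1) by (auto simp: lambda_spanning_def null_sets_def)
  ultimately show ?thesis by (intro approximable_closure) auto
qed

end

section \<open>Averages that are small from the first one on\<close>

lemma sum_lessThan_add:
  fixes f :: "nat \<Rightarrow> 'b::comm_monoid_add"
  shows "(\<Sum>m<a + b. f m) = (\<Sum>m<a. f m) + (\<Sum>m<b. f (a + m))"
  by (induction b) (simp_all add: add.assoc)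

text \<open>Otherwise consecutive windows of large average would tile an initial segment.\<close>
lemma exists_shift_small_averages:
  fixes f :: "nat \<Rightarrow> real"
  assumes \<epsilon>: "\<epsilon> > 0" and ev: "\<forall>\<^sub>F N in sequentially. (\<Sum>m<N. f m) \<le> \<epsilon> * real N"
  shows "\<exists>M. \<forall>N. (\<Sum>m<N. f (M + m)) \<le> 2 * \<epsilon> * real N"
proof (rule ccontr)
  assume "\<not> ?thesis"
  then have "\<forall>M. \<exists>N. (\<Sum>m<N. f (M + m)) > 2 * \<epsilon> * real N" by (meson not_le)
  then obtain g where g: "\<And>M. (\<Sum>m<g M. f (M + m)) > 2 * \<epsilon> * real (g M)" by metis
  \<comment> \<open>The strict inequality excludes empty windows, so the endpoints
    \<open>s i\<close> below increase strictly.\<close>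
  have g1: "g M \<ge> 1" for M using g[of M] by (cases "g M") auto
  define s where "s i = ((\<lambda>M. M + g M) ^^ i) 0" for i
  have s: "s 0 = 0" "s (Suc i) = s i + g (s i)" for i by (simp_all add: s_def)
  have s_ge: "s i \<ge> i" for i
  proof (induction i)
    case (Suc i)
    then show ?case using g1[of "s i"] by (simp add: s)
  qed simp
  have lower: "2 * \<epsilon> * real (s i) \<le> (\<Sum>m<s i. f m)" for i
  proof (induction i)
    case (Suc i)
    then show ?case using g[of "s i"] by (simp add: s sum_lessThan_add algebra_simps)
  qed (simp add: s)
  obtain N0 where N0: "\<And>N. N \<ge> N0 \<Longrightarrow> (\<Sum>m<N. f m) \<le> \<epsilon> * real N"
    using ev by (auto simp: eventually_sequentially)
  define n where "n = s (Suc N0)"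
  have "n \<ge> N0" "n > 0" using s_ge[of "Suc N0"] by (auto simp: n_def)
  then have "2 * \<epsilon> * real n \<le> \<epsilon> * real n"
    using N0[of n] lower[of "Suc N0"] unfolding n_def by linarith
  moreover have "0 < \<epsilon> * real n" using \<epsilon> \<open>n > 0\<close> by simp
  ultimately show False by linarith
qed

section \<open>Inductive construction of the vector\<close>

context complex_operator
begin

definition eigenvector_sum :: "(nat \<Rightarrow> nat set) \<Rightarrow> 'a \<Rightarrow> complex set \<Rightarrow> bool" where
  "eigenvector_sum A x Z \<longleftrightarrow> finite Z \<and> Z \<subseteq> sphere 0 1 \<and> equidistributed_along A Z \<and>
     (\<exists>e. (\<forall>z\<in>Z. T (e z) = sc z (e z)) \<and> x = (\<Sum>z\<in>Z. e z))"

lemma funpow_eigenvector_sum: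
  assumes "\<forall>z\<in>Z. T (e z) = sc z (e z)"
  shows "(T ^^ m) (\<Sum>z\<in>Z. e z) = (\<Sum>z\<in>Z. sc (z ^ m) (e z))"
  unfolding funpow_sum using assms by (intro sum.cong refl funpow_eigenvector) auto

text \<open>An approximation of \<open>v - x\<close> by eigenvectors is replaced by its iterate
  under \<open>T ^^ M\<close>, which makes the averages of \<open>y - x\<close> small for every
  \<open>N\<close>. This introduces the phases \<open>z ^ M\<close>, so \<open>y\<close> itself need
  not be near \<open>v\<close>. The phases are undone at the times when \<open>z ^ m\<close> is near
  the conjugate of \<open>z ^ M\<close> on the new eigenvalues and near 1 on the old ones, and these
  times have positive lower density in \<open>A j\<close>.\<close>

lemma exists_next_eigenvector_sum:
  assumes app: "\<And>w. approximable A w" and x: "eigenvector_sum A x Z" and \<eta>: "\<eta> > 0"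
    and V: "open V" "V \<noteq> {}"
  shows "\<exists>y Z' v r c. eigenvector_sum A y Z' \<and> (\<forall>N. (\<Sum>m<N. norm ((T ^^ m) (y - x))) \<le> \<eta> * real N) \<and>
     r > 0 \<and> c > 0 \<and> ball v (2 * r) \<subseteq> V \<and>
     (\<forall>\<^sub>F N in sequentially. c * real N \<le> real (card ({m\<in>A j. norm ((T ^^ m) y - v) < r} \<inter> {..<N})))"
proof -
  obtain e where Z: "finite Z" "Z \<subseteq> sphere 0 1" "equidistributed_along A Z"
    and e: "\<forall>z\<in>Z. T (e z) = sc z (e z)" "x = (\<Sum>z\<in>Z. e z)"
    using x by (auto simp: eigenvector_sum_def)
  obtain v where "v \<in> V" using V(2) by blast
  then obtain r0 where r0: "r0 > 0" "ball v r0 \<subseteq> V" using V(1) openE by blast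
  define r where "r = r0 / 2"
  have r: "r > 0" "ball v (2 * r) \<subseteq> V" using r0 by (auto simp: r_def)
  define \<epsilon> where "\<epsilon> = min (r / 2) (\<eta> / 2)"
  have \<epsilon>: "\<epsilon> > 0" "\<epsilon> \<le> r / 2" "2 * \<epsilon> \<le> \<eta>" using r \<eta> by (auto simp: \<epsilon>_def)
  obtain W d where "eigenvector_sum_approximation A \<epsilon> Z (v - x) W d"
    by (rule approximableE[OF app \<epsilon>(1) Z])
  note W = eigenvector_sum_approximationD[OF this]
  obtain M where M: "\<And>N. (\<Sum>m<N. norm (\<Sum>z\<in>W. sc (z ^ (M + m)) (d z))) \<le> 2 * \<epsilon> * real N"
    using exists_shift_small_averages[OF \<epsilon>(1) W(7)] by blast
  \<comment> \<open>\<open>g\<close> holds the phases and \<open>f\<close> the eigenvectors before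
    the iteration; both are determined because \<open>Z\<close> and \<open>W\<close> are
    disjoint.\<close>
  define g where "g z = (if z \<in> W then z ^ M else 1)" for z
  define f where "f z = (if z \<in> W then d z else e z)" for z
  define y where "y = (\<Sum>z\<in>Z \<union> W. sc (g z) (f z))"
  have split: "(\<Sum>z\<in>Z \<union> W. h z (g z) (f z)) = (\<Sum>z\<in>Z. h z 1 (e z)) + (\<Sum>z\<in>W. h z (z ^ M) (d z))"
    for h :: "complex \<Rightarrow> complex \<Rightarrow> 'a \<Rightarrow> 'a"
  proof -
    have "(\<Sum>z\<in>Z. h z (g z) (f z)) = (\<Sum>z\<in>Z. h z 1 (e z))"
      using W(3) by (intro sum.cong) (auto simp: g_def f_def)
    then show ?thesis using Z(1) W(1,3) by (simp add: sum.union_disjoint g_def f_def)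
  qed
  have eig: "\<forall>z\<in>Z \<union> W. T (sc (g z) (f z)) = sc z (sc (g z) (f z))"
  proof
    fix z assume "z \<in> Z \<union> W"
    then have "T (f z) = sc z (f z)" using e(1) W(5) by (auto simp: f_def)
    then show "T (sc (g z) (f z)) = sc z (sc (g z) (f z))"
      by (simp add: T_sc mult.commute flip: sc_simps(3))
  qed
  have Tm: "(T ^^ m) y = (\<Sum>z\<in>Z \<union> W. sc (z ^ m * g z) (f z))" for m
    unfolding y_def funpow_eigenvector_sum[OF eig] by (simp only: sc_simps(3))
  have ZW: "finite (Z \<union> W)" "Z \<union> W \<subseteq> sphere 0 1" using Z W by auto
  have "eigenvector_sum A y (Z \<union> W)"
    unfolding eigenvector_sum_def y_def using ZW W(4) eig by (intro conjI exI[of _ "\<lambda>z. sc (g z) (f z)"]) auto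
  moreover have "(\<Sum>m<N. norm ((T ^^ m) (y - x))) \<le> \<eta> * real N" for N
  proof -
    have "(T ^^ m) (y - x) = (\<Sum>z\<in>W. sc (z ^ (M + m)) (d z))" for m
      unfolding funpow_diff Tm using split[of "\<lambda>z u w. sc (z ^ m * u) w"]
      by (simp add: e(2) funpow_eigenvector_sum[OF e(1)] power_add mult.commute)
    then have "(\<Sum>m<N. norm ((T ^^ m) (y - x))) \<le> 2 * \<epsilon> * real N" using M by simp
    also have "\<dots> \<le> \<eta> * real N" using \<epsilon>(3) by (intro mult_right_mono) auto
    finally show ?thesis .
  qed
  moreover have "pos_lower_density {m\<in>A j. norm ((T ^^ m) y - v) < r}"
  proof -
    define b where "b = (\<Sum>z\<in>Z \<union> W. norm (f z)) + 1"
    have b: "b > 0" unfolding b_def by (intro add_nonneg_pos sum_nonneg) auto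
    \<comment> \<open>Chosen so that phase errors below \<open>\<delta>\<close> move the sum by less
      than \<open>r / 2\<close>; the other \<open>r / 2\<close> is left for the distance of the sum
      of the \<open>f z\<close> from \<open>v\<close>.\<close>
    define \<delta> where "\<delta> = r / 2 / b"
    have \<delta>: "\<delta> > 0" "\<delta> * b = r / 2" using r b by (auto simp: \<delta>_def)
    have g1: "cmod (g z) = 1" if "z \<in> Z \<union> W" for z
      using that ZW(2) by (auto simp: g_def norm_power)
    have "pos_lower_density {m\<in>A j. \<forall>z\<in>Z \<union> W. cmod (z ^ m - cnj (g z)) < \<delta>}"
      using g1 by (intro equidistributed_alongD[OF W(4) _ \<delta>(1)]) auto
    then show ?thesis
    proof (rule pos_lower_density_mono, safe)
      fix m assume m: "\<forall>z\<in>Z \<union> W. cmod (z ^ m - cnj (g z)) < \<delta>"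
      have "norm ((T ^^ m) y - (\<Sum>z\<in>Z \<union> W. f z)) = norm (\<Sum>z\<in>Z \<union> W. sc (z ^ m * g z - 1) (f z))"
        unfolding Tm by (simp add: sum_subtractf linear_diff[OF linear_sc_left])
      also have "\<dots> \<le> (\<Sum>z\<in>Z \<union> W. \<delta> * norm (f z))"
      proof (rule sum_norm_le)
        fix z assume z: "z \<in> Z \<union> W"
        have "g z * cnj (g z) = 1" using g1[OF z] complex_norm_square[of "g z"] by simp
        then have "z ^ m * g z - 1 = (z ^ m - cnj (g z)) * g z" by (simp add: algebra_simps)
        then have "cmod (z ^ m * g z - 1) = cmod (z ^ m - cnj (g z))" by (simp add: norm_mult g1[OF z])
        then show "norm (sc (z ^ m * g z - 1) (f z)) \<le> \<delta> * norm (f z)"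
          using m z by (simp add: sc_simps(5) mult_right_mono less_imp_le)
      qed
      also have "\<dots> = \<delta> * (b - 1)" by (simp add: b_def sum_distrib_left)
      also have "\<dots> < r / 2" using \<delta> by (simp add: algebra_simps)
      finally have 1: "norm ((T ^^ m) y - (\<Sum>z\<in>Z \<union> W. f z)) < r / 2" .
      have "(\<Sum>z\<in>Z \<union> W. f z) = x + (\<Sum>z\<in>W. d z)"
        using split[of "\<lambda>_ _ w. w"] by (simp add: e(2))
      then have 2: "norm ((\<Sum>z\<in>Z \<union> W. f z) - v) < r / 2"
        using W(6) \<epsilon>(2) by (simp add: algebra_simps)
      show "norm ((T ^^ m) y - v) < r"
        using norm_triangle_ineq[of "(T ^^ m) y - (\<Sum>z\<in>Z \<union> W. f z)" "(\<Sum>z\<in>Z \<union> W. f z) - v"] 1 2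
        by simp
    qed
  qed
  then obtain c where "c > 0"
    "\<forall>\<^sub>F N in sequentially. c * real N \<le> real (card ({m\<in>A j. norm ((T ^^ m) y - v) < r} \<inter> {..<N}))"
    unfolding pos_lower_density_iff by blast
  ultimately show ?thesis using r by blast
qed

text \<open>Stage \<open>n\<close> treats the index \<open>n\<close> once and for all. The sizes of
  later perturbations are fixed only after the radius and the density obtained at that stage are
  known.\<close>

lemma hereditarily_frequently_hypercyclic_if_approximable:
  assumes app: "\<And>A w. (\<And>j. pos_lower_density (A j)) \<Longrightarrow> approximable A w"
  shows "hereditarily_frequently_hypercyclic T"
  unfolding hereditarily_frequently_hypercyclic_def
proof (intro allI impI)
  fix J :: "nat set" and V0 :: "nat \<Rightarrow> 'a set" and A0 :: "nat \<Rightarrow> nat set"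
  assume VA0: "\<forall>j\<in>J. open (V0 j) \<and> V0 j \<noteq> {} \<and> pos_lower_density (A0 j)"
  \<comment> \<open>Indices outside \<open>J\<close> get the whole space and all of the natural
    numbers, so that every stage has a task.\<close>
  define V where "V j = (if j \<in> J then V0 j else UNIV)" for j
  define A where "A j = (if j \<in> J then A0 j else UNIV)" for j
  have V: "open (V j)" "V j \<noteq> {}" and A: "pos_lower_density (A j)" for j
    using VA0 by (auto simp: V_def A_def pos_lower_density_UNIV)
  \<comment> \<open>The state consists of the vector, its eigenvalues and the bound
    \<open>\<eta>\<close> for the orbit averages of the next perturbation.\<close>
  define P where "P n st = (case st of (x, Z, \<eta>) \<Rightarrow> eigenvector_sum A x Z \<and> 0 < \<eta> \<and> \<eta> \<le> (1/2::real) ^ n)"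
    for n :: nat and st
  define Q where "Q n st st' = (case st of (x, Z :: complex set, \<eta>) \<Rightarrow> case st' of (y, Z' :: complex set, \<eta>') \<Rightarrow>
      \<eta>' \<le> \<eta> / 2 \<and> (\<forall>N. (\<Sum>m<N. norm ((T ^^ m) (y - x))) \<le> \<eta> * real N) \<and>
      (\<exists>v r c. r > 0 \<and> c > 0 \<and> ball v (2 * r) \<subseteq> V n \<and> \<eta>' \<le> r * c / 8 \<and>
        (\<forall>\<^sub>F N in sequentially. c * real N \<le> real (card ({m\<in>A n. norm ((T ^^ m) y - v) < r} \<inter> {..<N})))))"
    for n :: nat and st st'
  have "\<exists>st. \<forall>n. P n (st n) \<and> Q n (st n) (st (Suc n))"
  proof (rule dependent_nat_choice)
    show "\<exists>st. P 0 st"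
      using A by (intro exI[of _ "(0, {}, 1)"])
        (auto simp: P_def eigenvector_sum_def equidistributed_along_def)
  next
    fix st n assume "P n st"
    then obtain x Z \<eta> where st: "st = (x, Z, \<eta>)" and x: "eigenvector_sum A x Z" and \<eta>: "0 < \<eta>" "\<eta> \<le> (1/2) ^ n"
      by (auto simp: P_def split: prod.splits)
    obtain y Z' v r c where y: "eigenvector_sum A y Z'"
      "\<And>N. (\<Sum>m<N. norm ((T ^^ m) (y - x))) \<le> \<eta> * real N"
      and rc: "r > 0" "c > 0" "ball v (2 * r) \<subseteq> V n"
      "\<forall>\<^sub>F N in sequentially. c * real N \<le> real (card ({m\<in>A n. norm ((T ^^ m) y - v) < r} \<inter> {..<N}))"
      using exists_next_eigenvector_sum[OF app[of A, OF A] x \<eta>(1) V, of n n] by blast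
    \<comment> \<open>Halving keeps the sum of all later bounds below \<open>2 * \<eta>'\<close>.
      With \<open>\<eta>' \<le> r * c / 8\<close> the later perturbations then have averages at most
      \<open>r * c / 4\<close>.\<close>
    define \<eta>' where "\<eta>' = min (\<eta> / 2) (r * c / 8)"
    have "P (Suc n) (y, Z', \<eta>')"
      using y(1) \<eta> rc by (auto simp: P_def \<eta>'_def min_le_iff_disj)
    moreover have "Q n st (y, Z', \<eta>')"
      unfolding Q_def st prod.case
    proof (intro conjI exI allI)
      show "\<eta>' \<le> \<eta> / 2" "\<eta>' \<le> r * c / 8" by (auto simp: \<eta>'_def)
    qed (fact y rc)+
    ultimately show "\<exists>st'. P (Suc n) st' \<and> Q n st st'" by blast
  qed
  then obtain st where st: "\<And>n. P n (st n)" "\<And>n. Q n (st n) (st (Suc n))" by blast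
  define s where "s n = fst (st n)" for n
  define \<eta> where "\<eta> n = snd (snd (st n))" for n
  have \<eta>: "0 < \<eta> n" "\<eta> n \<le> (1/2) ^ n" for n
    using st(1)[of n] by (auto simp: P_def \<eta>_def split: prod.splits)
  have Q: "\<eta> (Suc n) \<le> \<eta> n / 2" "(\<Sum>m<N. norm ((T ^^ m) (s (Suc n) - s n))) \<le> \<eta> n * real N"
    "\<exists>v r c. r > 0 \<and> c > 0 \<and> ball v (2 * r) \<subseteq> V n \<and> \<eta> (Suc n) \<le> r * c / 8 \<and>
        (\<forall>\<^sub>F N in sequentially. c * real N \<le>
           real (card ({m\<in>A n. norm ((T ^^ m) (s (Suc n)) - v) < r} \<inter> {..<N})))" for n N
    using st(2)[of n] by (auto simp: Q_def s_def \<eta>_def split: prod.splits)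
  \<comment> \<open>Telescoping: \<open>\<eta> (Suc n) \<le> \<eta> n / 2\<close> gives
    \<open>\<eta> n \<le> 2 * (\<eta> n - \<eta> (Suc n))\<close>. The case \<open>N = 1\<close>
    bounds the norms themselves and yields the Cauchy property.\<close>
  have diff: "(\<Sum>m<N. norm ((T ^^ m) (s (n + k) - s n))) \<le> 2 * (\<eta> n - \<eta> (n + k)) * real N" for n k N
  proof (induction k)
    case 0
    then show ?case by (simp add: linear_0[OF linear_funpow])
  next
    case (Suc k)
    have "(T ^^ m) (s (n + Suc k) - s n) = (T ^^ m) (s (Suc (n + k)) - s (n + k)) + (T ^^ m) (s (n + k) - s n)" for m
      by (simp flip: funpow_add_right)
    then have "(\<Sum>m<N. norm ((T ^^ m) (s (n + Suc k) - s n)))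
       \<le> (\<Sum>m<N. norm ((T ^^ m) (s (Suc (n + k)) - s (n + k))) + norm ((T ^^ m) (s (n + k) - s n)))"
      by (intro sum_mono) (simp only: norm_triangle_ineq)
    also have "\<dots> \<le> \<eta> (n + k) * real N + 2 * (\<eta> n - \<eta> (n + k)) * real N"
      unfolding sum.distrib by (intro add_mono Q(2) Suc)
    also have "\<dots> = (\<eta> (n + k) + 2 * (\<eta> n - \<eta> (n + k))) * real N" by (simp add: algebra_simps)
    also have "\<dots> \<le> 2 * (\<eta> n - \<eta> (n + Suc k)) * real N"
      using Q(1)[of "n + k"] by (intro mult_right_mono) auto
    finally show ?case .
  qed
  have "Cauchy s"
  proof (rule metric_CauchyI)
    fix \<epsilon> :: real assume "\<epsilon> > 0"
    then obtain M where M: "(1/2::real) ^ M < \<epsilon> / 4" using real_arch_pow_inv[of "\<epsilon> / 4" "1/2"] by auto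
    have near: "norm (s n - s M) < \<epsilon> / 2" if n: "n \<ge> M" for n
    proof -
      have "norm (s n - s M) \<le> 2 * (\<eta> M - \<eta> n)"
        using diff[of M "n - M" 1] n by simp
      then show ?thesis using \<eta>[of M] \<eta>(1)[of n] M by simp
    qed
    have "dist (s m) (s n) < \<epsilon>" if "m \<ge> M" "n \<ge> M" for m n
      using near[OF that(1)] near[OF that(2)] dist_triangle2[of "s m" "s n" "s M"] by (simp add: dist_norm)
    then show "\<exists>M. \<forall>m\<ge>M. \<forall>n\<ge>M. dist (s m) (s n) < \<epsilon>" by blast
  qed
  then obtain x where x: "s \<longlonglongrightarrow> x" using Cauchy_convergent convergent_def by blast
  have tail: "(\<Sum>m<N. norm ((T ^^ m) (x - s n))) \<le> 2 * \<eta> n * real N" for n N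
  proof (rule LIMSEQ_le_const2)
    show "(\<lambda>k. \<Sum>m<N. norm ((T ^^ m) (s (n + k) - s n))) \<longlonglongrightarrow> (\<Sum>m<N. norm ((T ^^ m) (x - s n)))"
    proof (intro tendsto_sum tendsto_norm bounded_linear.tendsto[OF bounded_linear_funpow] tendsto_diff tendsto_const)
      show "(\<lambda>k. s (n + k)) \<longlonglongrightarrow> x" using LIMSEQ_ignore_initial_segment[OF x, of n] by (simp add: add.commute)
    qed
    have "2 * (\<eta> n - \<eta> (n + k)) * real N \<le> 2 * \<eta> n * real N" for k
      using \<eta>(1)[of "n + k"] by (intro mult_right_mono) auto
    then show "\<exists>K. \<forall>k\<ge>K. (\<Sum>m<N. norm ((T ^^ m) (s (n + k) - s n))) \<le> 2 * \<eta> n * real N"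
      using diff order_trans by blast
  qed
  have "pos_lower_density (N_T T x (V n) \<inter> A n)" for n
  proof -
    obtain v r c where rc: "r > 0" "c > 0" "ball v (2 * r) \<subseteq> V n" "\<eta> (Suc n) \<le> r * c / 8"
      "\<forall>\<^sub>F N in sequentially. c * real N \<le>
         real (card ({m\<in>A n. norm ((T ^^ m) (s (Suc n)) - v) < r} \<inter> {..<N}))"
      using Q(3) by blast
    define H where "H = {m\<in>A n. norm ((T ^^ m) (s (Suc n)) - v) < r}"
    define B where "B N = {m\<in>{..<N}. r \<le> norm ((T ^^ m) (x - s (Suc n)))}" for N
    \<comment> \<open>Markov's inequality: the perturbation reaches \<open>r\<close> on at most a
      proportion \<open>c / 4\<close> of the times. At least \<open>3 * c / 4\<close> of the returns
      found at stage \<open>n\<close> therefore survive in the limit.\<close>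
    have B: "real (card (B N)) \<le> c / 4 * real N" for N
    proof -
      have "real (card (B N)) * r \<le> (\<Sum>m\<in>B N. norm ((T ^^ m) (x - s (Suc n))))"
        by (rule sum_bounded_below[of "B N" r, simplified]) (auto simp: B_def)
      also have "\<dots> \<le> (\<Sum>m<N. norm ((T ^^ m) (x - s (Suc n))))"
        by (intro sum_mono2) (auto simp: B_def)
      also have "\<dots> \<le> 2 * \<eta> (Suc n) * real N" by (rule tail)
      also have "\<dots> \<le> 2 * (r * c / 8) * real N" using rc(4) by (intro mult_right_mono) (auto simp: mult_ac)
      finally have "r * real (card (B N)) \<le> r * (c / 4 * real N)" by (simp add: mult_ac)
      then show ?thesis using rc(1) by (simp only: mult_le_cancel_left_pos)
    qed
    have sub: "H \<inter> {..<N} \<subseteq> (N_T T x (V n) \<inter> A n \<inter> {..<N}) \<union> B N" for N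
    proof
      fix m assume m: "m \<in> H \<inter> {..<N}"
      show "m \<in> (N_T T x (V n) \<inter> A n \<inter> {..<N}) \<union> B N"
      proof (cases "m \<in> B N")
        case False
        then have "norm ((T ^^ m) (x - s (Suc n))) < r" using m by (auto simp: B_def)
        moreover have "norm ((T ^^ m) (s (Suc n)) - v) < r" using m by (auto simp: H_def)
        ultimately have "norm ((T ^^ m) x - v) < 2 * r"
          using norm_triangle_ineq[of "(T ^^ m) (x - s (Suc n))" "(T ^^ m) (s (Suc n)) - v"]
          by (simp add: funpow_diff)
        then have "(T ^^ m) x \<in> V n" using rc(3) by (auto simp: dist_norm norm_minus_commute)
        then show ?thesis using m by (auto simp: N_T_def H_def)
      qed simp
    qed
    have "\<forall>\<^sub>F N in sequentially. 3 * c / 4 * real N \<le> real (card (N_T T x (V n) \<inter> A n \<inter> {..<N}))"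
      using rc(5)[folded H_def]
    proof eventually_elim
      case (elim N)
      have "card (H \<inter> {..<N}) \<le> card ((N_T T x (V n) \<inter> A n \<inter> {..<N}) \<union> B N)"
        by (intro card_mono sub) (auto simp: B_def)
      also have "\<dots> \<le> card (N_T T x (V n) \<inter> A n \<inter> {..<N}) + card (B N)" by (rule card_Un_le)
      finally have "real (card (H \<inter> {..<N})) \<le> real (card (N_T T x (V n) \<inter> A n \<inter> {..<N})) + real (card (B N))"
        by (simp flip: of_nat_add)
      with elim B[of N] show ?case by (simp add: field_simps)
    qed
    then show ?thesis unfolding pos_lower_density_iff using rc(2) by (intro exI[of _ "3 * c / 4"]) auto
  qed
  then have "\<forall>j\<in>J. pos_lower_density (N_T T x (V0 j) \<inter> A0 j)" by (metis V_def A_def)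
  then show "\<exists>x. \<forall>j\<in>J. pos_lower_density (N_T T x (V0 j) \<inter> A0 j)" by blast
qed

end

theorem theorem3p1:
  fixes sc :: "complex \<Rightarrow> 'a::banach \<Rightarrow> 'a"
    and T :: "'a \<Rightarrow> 'a"
    and I :: "'i set"
    and E :: "'i \<Rightarrow> complex \<Rightarrow> 'a"
  assumes "complex_structure sc"
    and "separable_space_UNIV TYPE('a)"
    and "bounded_linear T"
    and "\<forall>c x. T (sc c x) = sc c (T x)"
    and "countable I"
    and "\<forall>i\<in>I. T_eigenvector_field sc T (E i)"
    and "lambda_spanning sc I E"
    and "has_type TYPE('a) 2 \<or>
         (\<exists>p. 1 \<le> p \<and> p < 2 \<and> has_type TYPE('a) p \<and>
              (\<forall>i\<in>I. \<exists>\<alpha>. \<alpha> > 1 / p - 1 / 2 \<and> holder_on_T \<alpha> (E i)))"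
  shows "hereditarily_frequently_hypercyclic T"
proof -
  interpret complex_operator sc T
    using assms(1,3,4) by (intro complex_operator.intro) auto
  show ?thesis
    using assms(2,5,6,7)
    by (intro hereditarily_frequently_hypercyclic_if_approximable approximable_all) auto
qed

end
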